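(* For $q\in(-1,0)\cup(0,1)$ and $x\in\mathbb{C}$ let $\theta(q,x):=\sum_{j=0}^{\infty}q^{j(j+1)/2}x^j$. Then: (1) For any $q\in(0,1)$, all complex conjugate pairs of zeros of $\theta(q,\cdot)$ belong to the set $$\{x\in\mathbb{C} : \mathrm{Re}\,x\in(-5792.7,0),\ |\mathrm{Im}\,x|<132\}\ \cup\ \{x\in\mathbb{C} : |x|<18\}.$$ (2) For any $q\in(-1,0)$, all complex conjugate pairs of zeros of $\theta(q,\cdot)$ belong to the set $$\{x\in\mathbb{C} : |\mathrm{Re}\,x|<364.2,\ |\mathrm{Im}\,x|<132\}.$$
   Context: For each fixed $q$ with $|q|<1$, the series $\theta(q,x)=\sum_{j=0}^{\infty}q^{j(j+1)/2}x^j$ defines an entire function of $x$, called the partial theta function. For real $q$ it has real coefficients, so its non-real zeros come in complex conjugate pairs $\{x,\bar{x}\}$ with $\mathrm{Im}\,x\neq 0$; "complex conjugate pairs of zeros" refers to these non-real zeros. *)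

theory Defs
  imports "HOL-Analysis.Analysis"
begin

(* The exponent uses division on naturals, which is exact here because j * (j + 1) is even. *)
definition partial_theta :: "complex \<Rightarrow> complex \<Rightarrow> complex" where
  "partial_theta q x = (\<Sum>j. q ^ (j * (j + 1) div 2) * x ^ j)"

(* The series converges on all of the complex plane, so the value of suminf is its genuine sum. *)
lemma summable_partial_theta:
  fixes q x :: complex
  assumes "norm q < 1"
  shows "summable (\<lambda>j. q ^ (j * (j + 1) div 2) * x ^ j)"
proof -
  have "(\<lambda>n. norm q ^ Suc n * norm x) \<longlonglongrightarrow> 0 * norm x"
    using assms by (intro tendsto_mult tendsto_const LIMSEQ_Suc LIMSEQ_realpow_zero) auto
  then have "\<forall>\<^sub>F n in sequentially. norm q ^ Suc n * norm x < 1/2"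
    by (rule order_tendstoD) simp
  then obtain N where N: "\<And>n. n \<ge> N \<Longrightarrow> norm q ^ Suc n * norm x < 1/2"
    by (auto simp: eventually_sequentially)
  show ?thesis
  proof (rule summable_ratio_test[of "1/2" N])
    fix n assume n: "n \<ge> N"
    let ?t = "\<lambda>j. q ^ (j * (j + 1) div 2) * x ^ j"
    have "Suc n * (Suc n + 1) div 2 = n * (n + 1) div 2 + Suc n"
    proof -
      have "Suc n * (Suc n + 1) = n * (n + 1) + 2 * Suc n" by simp
      then show ?thesis by (simp only: div_mult_self2)
    qed
    then have "?t (Suc n) = (q ^ Suc n * x) * ?t n"
      by (simp only: power_add power_Suc mult_ac)
    then have "norm (?t (Suc n)) = (norm q ^ Suc n * norm x) * norm (?t n)"
      by (simp only: norm_mult norm_power)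
    also have "\<dots> \<le> 1/2 * norm (?t n)"
      using N[OF n] by (intro mult_right_mono) auto
    finally show "norm (?t (Suc n)) \<le> 1/2 * norm (?t n)" .
  qed simp
qed

(* For real q the zeros are symmetric about the real axis. *)
lemma partial_theta_of_real_cnj:
  assumes "\<bar>q\<bar> < 1"
  shows "partial_theta (of_real q) (cnj x) = cnj (partial_theta (of_real q) x)"
proof -
  have "(\<lambda>j. of_real q ^ (j * (j + 1) div 2) * x ^ j) sums partial_theta (of_real q) x"
    unfolding partial_theta_def using assms by (intro summable_sums summable_partial_theta) simp
  then have "(\<lambda>j. cnj (of_real q ^ (j * (j + 1) div 2) * x ^ j)) sums cnj (partial_theta (of_real q) x)"
    by (simp only: sums_cnj)
  then show ?thesis
    unfolding partial_theta_def by (simp add: sums_iff)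
qed

(* The members of the complex conjugate pairs of zeros. *)
definition nonreal_zeros :: "real \<Rightarrow> complex set" where
  "nonreal_zeros q = {x. partial_theta (of_real q) x = 0 \<and> Im x \<noteq> 0}"

end

theory Submission
  imports Defs "HOL-Complex_Analysis.Complex_Analysis"
begin

text \<open>
  Write \<theta>(x) for \<theta>(q, x), \<Theta>(x) = \<theta>(x) + \<theta>(1/x)/x for the bilateral series, and \<tau> = - ln |q|.
  The Jacobi triple product bounds \<Theta> from below: |\<Theta>| \<ge> exp ((n^2 \<tau>^2 - \<pi>^2) / (2\<tau>)) on the
  circle |x| = exp ((n + 1/2) \<tau>), while |\<Theta> - \<theta>| \<le> 1 / (|x| - 1).

  The functional equation \<theta>(x/q) = 1 + x \<theta>(x) does the rest. If |x \<theta>(x)| \<ge> 4/3 on one circle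
  |x| = r with r \<ge> 4 |q|, the same bound passes to the circles of radii r/|q|^k, and by Rouche's
  theorem each of the annuli between consecutive circles contains exactly one zero. That zero has
  to equal its own conjugate, so every non-real zero lies in |x| < r. Such an r < 132 exists unless
  |q| \<le> 1/6, and in this case all zeros are real.

  For q > 0 and Re x \<ge> 0 we have |1 + x q^m|^2 \<ge> 1 + |x|^2 q^(2m), which compares |\<Theta>(q, x)|^2 with
  \<Theta>(q^2, |x|^2), a series of positive terms that is bounded from below by its largest term; hence
  there are no zeros with Re x \<ge> 0 and |x| \<ge> 18.
\<close>

section \<open>The finite Jacobi triple product\<close>

definition tri :: "nat \<Rightarrow> nat" where
  "tri n = n * (n + 1) div 2"

lemma tri_0 [simp]: "tri 0 = 0"
  by (simp add: tri_def)

lemma tri_Suc [simp]: "tri (Suc n) = tri n + Suc n"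
proof -
  have "Suc n * (Suc n + 1) = n * (n + 1) + 2 * Suc n" by simp
  then show ?thesis unfolding tri_def by (simp only: div_mult_self2)
qed

lemma of_nat_tri: "2 * real (tri n) = real n * (real n + 1)"
  by (induction n) (auto simp: algebra_simps)

lemma le_tri: "n \<le> tri n"
  by (induction n) auto

section \<open>Gaussian binomial coefficients and their Pascal rules\<close>

definition qfact :: "'a::field \<Rightarrow> nat \<Rightarrow> 'a" where
  "qfact q n = (\<Prod>i=1..n. 1 - q ^ i)"

text \<open>Built from the unnormalised products (q; q)_n: the powers of 1 - q that a normalisation
  would bring in cancel in the quotient. The value 0 for k > n lets the Pascal rules hold at the
  boundary.\<close>

definition qbin :: "'a::field \<Rightarrow> nat \<Rightarrow> nat \<Rightarrow> 'a" where
  "qbin q n k = (if k \<le> n then qfact q n / (qfact q k * qfact q (n - k)) else 0)"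

lemma qfact_0 [simp]: "qfact q 0 = 1"
  by (simp add: qfact_def)

lemma qfact_Suc [simp]: "qfact q (Suc n) = qfact q n * (1 - q ^ Suc n)"
  by (simp add: qfact_def)

lemma qbin_eq_0: "n < k \<Longrightarrow> qbin q n k = 0"
  by (simp add: qbin_def)

lemma qbin_symmetric: "k \<le> n \<Longrightarrow> qbin q n (n - k) = qbin q n k"
  by (simp add: qbin_def mult.commute)

context
  fixes q :: "'a::field"
  assumes q_not_root: "\<And>i. q ^ Suc i \<noteq> 1"
begin

lemma qfact_nonzero: "qfact q n \<noteq> 0"
proof (induction n)
  case (Suc n)
  then show ?case using q_not_root[of n] by (simp del: power_Suc)
qed simp

lemma qbin_0 [simp]: "qbin q n 0 = 1"
  using qfact_nonzero by (simp add: qbin_def)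

lemma qbin_n [simp]: "qbin q n n = 1"
  using qfact_nonzero by (simp add: qbin_def)

text \<open>For n = k + d + 1 this rests on 1 - q^(n+1) = (1 - q^(k+1)) + q^(k+1) (1 - q^(d+1)). In
  the edge cases the coefficients are 0 or 1.\<close>

lemma qbin_Suc_Suc:
  "qbin q (Suc n) (Suc k) = qbin q n k + q ^ Suc k * qbin q n (Suc k)"
proof -
  consider "n < k" | "n = k" | d where "n = k + Suc d"
    by (metis less_iff_Suc_add linorder_neqE_nat add_Suc_right)
  then show ?thesis
  proof cases
    case 3
    have "1 - q ^ Suc k \<noteq> 0" "1 - q ^ Suc d \<noteq> 0"
      using q_not_root by (simp_all del: power_Suc)
    moreover have "q ^ Suc n = q ^ Suc k * q ^ Suc d"
      using 3 by (simp add: power_add)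
    ultimately show ?thesis
      using 3 qfact_nonzero
      by (simp add: qbin_def divide_simps del: power_Suc) (simp add: algebra_simps)
  qed (simp_all add: qbin_eq_0)
qed

text \<open>The mirror image of the first rule under the symmetry of the coefficients. It puts the
  power of q on the other summand, as the induction in \<open>rothe\<close> requires.\<close>

lemma qbin_Suc_Suc':
  assumes "k \<le> n"
  shows "qbin q (Suc n) (Suc k) = qbin q n (Suc k) + q ^ (n - k) * qbin q n k"
proof (cases "k = n")
  case False
  with assms have "qbin q (Suc n) (Suc k) = qbin q (Suc n) (Suc (n - Suc k))"
    using qbin_symmetric[of "Suc k" "Suc n" q] by (simp add: Suc_diff_Suc)
  also have "\<dots> = qbin q n (n - Suc k) + q ^ (n - k) * qbin q n (n - k)"
    using qbin_Suc_Suc[of n "n - Suc k"] assms False by (simp add: Suc_diff_Suc del: power_Suc)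
  finally show ?thesis
    using assms False by (simp add: qbin_symmetric)
qed (simp add: qbin_eq_0)

end

text \<open>Comparison of coefficients in a multiplication by a linear factor, the induction step
  shared by both product expansions below. With \<open>a (Suc n) = 0\<close> the top coefficient
  obeys the same recurrence as the others.\<close>

lemma sum_times_linear:
  fixes a b :: "nat \<Rightarrow> 'a::comm_ring_1"
  assumes "b 0 = \<alpha> * a 0" "\<And>k. k \<le> n \<Longrightarrow> b (Suc k) = \<alpha> * a (Suc k) + \<beta> * a k" "a (Suc n) = 0"
  shows "(\<Sum>k\<le>n. a k * x ^ k) * (\<alpha> + \<beta> * x) = (\<Sum>k\<le>Suc n. b k * x ^ k)"
proof -
  have "(\<Sum>k\<le>Suc n. b k * x ^ k) = b 0 + (\<Sum>k\<le>n. b (Suc k) * x ^ Suc k)"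
    by (subst sum.atMost_Suc_shift) simp
  also have "\<dots> = b 0 + (\<Sum>k\<le>n. \<alpha> * (a (Suc k) * x ^ Suc k) + \<beta> * x * (a k * x ^ k))"
    using assms(2) by (intro arg_cong2[where f = "(+)"] refl sum.cong) (auto simp: algebra_simps)
  also have "\<dots> = \<alpha> * (a 0 + (\<Sum>k\<le>n. a (Suc k) * x ^ Suc k)) + \<beta> * x * (\<Sum>k\<le>n. a k * x ^ k)"
    by (simp add: assms(1) sum.distrib sum_distrib_left algebra_simps)
  also have "a 0 + (\<Sum>k\<le>n. a (Suc k) * x ^ Suc k) = (\<Sum>k\<le>Suc n. a k * x ^ k)"
    by (subst sum.atMost_Suc_shift) simp
  also have "\<dots> = (\<Sum>k\<le>n. a k * x ^ k)" using assms(3) by simp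
  finally show ?thesis by (simp add: algebra_simps)
qed

section \<open>Rothe's identity, its two-sided form and the finite triple product\<close>

context
  fixes q :: "'a::field"
  assumes q_not_root: "\<And>i. q ^ Suc i \<noteq> 1"
begin

lemma rothe:
  "(\<Prod>m=1..M. 1 + x * q ^ m) = (\<Sum>k\<le>M. qbin q M k * q ^ tri k * x ^ k)"
proof (induction M)
  case (Suc M)
  have "(\<Prod>m=1..Suc M. 1 + x * q ^ m) =
        (\<Sum>k\<le>M. qbin q M k * q ^ tri k * x ^ k) * (1 + q ^ Suc M * x)"
    using Suc by (simp add: mult_ac)
  also have "\<dots> = (\<Sum>k\<le>Suc M. qbin q (Suc M) k * q ^ tri k * x ^ k)"
  proof (rule sum_times_linear)
    fix k assume k: "k \<le> M"
    \<comment> \<open>The exponents agree since (M - k) + (k + 1) = M + 1; the power from the Pascal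
      rule thus becomes that of the new factor.\<close>
    then have "q ^ (M - k) * q ^ tri (Suc k) = q ^ Suc M * q ^ tri k"
      by (simp flip: power_add power_Suc)
    then show "qbin q (Suc M) (Suc k) * q ^ tri (Suc k) =
        1 * (qbin q M (Suc k) * q ^ tri (Suc k)) + q ^ Suc M * (qbin q M k * q ^ tri k)"
      unfolding qbin_Suc_Suc'[OF q_not_root k] by (simp add: algebra_simps del: tri_Suc power_Suc)
  qed (simp_all add: qbin_eq_0 qbin_0[OF q_not_root])
  finally show ?case .
qed (simp add: qbin_0[OF q_not_root])

text \<open>Factors of the form q^m + x keep both sides polynomial in x. Term k has the bilateral
  index j = k - N, and its exponent is j(j+1)/2 for negative j too: j = -(i+1) gives
  \<open>tri i\<close> with i = \<open>N - Suc k\<close>.\<close>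

lemma two_sided_rothe:
  "(\<Prod>m=1..M. 1 + x * q ^ m) * (\<Prod>m<N. q ^ m + x) =
   (\<Sum>k\<le>M + N. qbin q (M + N) k * q ^ (if N \<le> k then tri (k - N) else tri (N - Suc k)) * x ^ k)"
proof (induction N)
  case 0
  then show ?case using rothe[of x M] by simp
next
  case (Suc N)
  define e where "e N k = (if N \<le> k then tri (k - N) else tri (N - Suc k))" for N k
  have e: "e (Suc N) (Suc k) = e N k" for k by (simp add: e_def)
  \<comment> \<open>With T(j) = j(j+1)/2 and j = k - N this is T(j) = T(j-1) + j, which also holds
    for negative j.\<close>
  have e': "N + e N k = e (Suc N) k + k" for k
  proof (cases "N < k")
    case True
    then obtain d where "k = N + Suc d" by (metis less_iff_Suc_add add_Suc_right)
    then show ?thesis by (simp add: e_def)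
  next
    case False
    then consider "N = k" | d where "N = k + Suc d" 
      by (metis less_iff_Suc_add linorder_neqE_nat add_Suc_right)
    then show ?thesis by cases (simp_all add: e_def)
  qed
  have "(\<Prod>m=1..M. 1 + x * q ^ m) * (\<Prod>m<Suc N. q ^ m + x) =
        (\<Sum>k\<le>M+N. qbin q (M+N) k * q ^ e N k * x ^ k) * (q ^ N + 1 * x)"
    using Suc by (simp add: mult_ac e_def)
  also have "\<dots> = (\<Sum>k\<le>Suc (M+N). qbin q (Suc (M+N)) k * q ^ e (Suc N) k * x ^ k)"
  proof (rule sum_times_linear)
    show "qbin q (Suc (M+N)) 0 * q ^ e (Suc N) 0 = q ^ N * (qbin q (M+N) 0 * q ^ e N 0)"
      using e'[of 0] by (simp add: qbin_0[OF q_not_root] flip: power_add)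
    fix k
    have "q ^ N * q ^ e N (Suc k) = q ^ Suc k * q ^ e N k"
      using e'[of "Suc k"] by (simp add: e add.commute del: power_Suc flip: power_add)
    then show "qbin q (Suc (M+N)) (Suc k) * q ^ e (Suc N) (Suc k) =
        q ^ N * (qbin q (M+N) (Suc k) * q ^ e N (Suc k)) + 1 * (qbin q (M+N) k * q ^ e N k)"
      unfolding qbin_Suc_Suc[OF q_not_root] e
      by (simp add: algebra_simps del: power_Suc)
  qed (simp_all add: qbin_eq_0)
  finally show ?case by (simp add: e_def)
qed

text \<open>Take M = N in the two-sided expansion, divide by \<open>x ^ N\<close> and split at k =
  N. Reversing the lower half and using the symmetry of \<open>qbin\<close> brings it to the same
  shape as the upper half.\<close>

lemma finite_jacobi_triple_product:
  assumes "x \<noteq> 0"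
  shows "(\<Prod>m=1..N. 1 + x * q ^ m) * (\<Prod>m<N. 1 + q ^ m / x) =
         (\<Sum>j\<le>N. qbin q (2 * N) (N + j) * q ^ tri j * x ^ j) +
         (\<Sum>j<N. qbin q (2 * N) (N + Suc j) * q ^ tri j * (1 / x) ^ j) / x"
proof -
  define f where "f k = qbin q (2*N) k * q ^ (if N \<le> k then tri (k - N) else tri (N - Suc k)) * x ^ k" for k
  have "{..2*N} = {N..2*N} \<union> {..<N}" by auto
  then have "(\<Sum>k\<le>2*N. f k) = (\<Sum>k\<in>{N..2*N}. f k) + (\<Sum>k<N. f k)"
    by (simp add: sum.union_disjoint disjoint_iff)
  also have "(\<Sum>k\<in>{N..2*N}. f k) = (\<Sum>j\<le>N. f (N + j))"
    by (rule sum.reindex_bij_witness[of _ "\<lambda>j. N + j" "\<lambda>k. k - N"]) auto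
  also have "(\<Sum>k<N. f k) = (\<Sum>j<N. f (N - Suc j))"
    by (rule sum.nat_diff_reindex[symmetric])
  also have "(\<Sum>j\<le>N. f (N + j)) = x ^ N * (\<Sum>j\<le>N. qbin q (2 * N) (N + j) * q ^ tri j * x ^ j)"
    by (simp add: f_def sum_distrib_left power_add mult_ac)
  also have "(\<Sum>j<N. f (N - Suc j)) =
             x ^ N * ((\<Sum>j<N. qbin q (2 * N) (N + Suc j) * q ^ tri j * (1 / x) ^ j) / x)"
    unfolding sum_distrib_left sum_divide_distrib
  proof (intro sum.cong refl)
    fix j assume "j \<in> {..<N}"
    then obtain d where d: "N = j + Suc d" by (auto simp: less_iff_Suc_add)
    have "qbin q (2 * N) (N - Suc j) = qbin q (2 * N) (N + Suc j)"
      using qbin_symmetric[of "N + Suc j" "2 * N" q] by (simp add: d)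
    moreover have "x ^ N * ((1 / x) ^ j / x) = x ^ (N - Suc j)"
      using assms by (simp add: d power_add field_simps)
    moreover have "f (N - Suc j) = qbin q (2 * N) (N - Suc j) * q ^ tri j * x ^ (N - Suc j)"
      by (simp add: f_def d)
    ultimately have "f (N - Suc j) =
        qbin q (2 * N) (N + Suc j) * q ^ tri j * (x ^ N * ((1 / x) ^ j / x))"
      by simp
    then show "f (N - Suc j) =
        x ^ N * (qbin q (2 * N) (N + Suc j) * q ^ tri j * (1 / x) ^ j / x)"
      by (simp only: mult_ac times_divide_eq_right times_divide_eq_left)
  qed
  finally have "(\<Prod>m=1..N. 1 + x * q ^ m) * (\<Prod>m<N. q ^ m + x) =
    x ^ N * ((\<Sum>j\<le>N. qbin q (2 * N) (N + j) * q ^ tri j * x ^ j) +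
         (\<Sum>j<N. qbin q (2 * N) (N + Suc j) * q ^ tri j * (1 / x) ^ j) / x)"
    using two_sided_rothe[of x N N] by (simp add: f_def mult_2 distrib_left)
  moreover have "(\<Prod>m<N. q ^ m + x) = x ^ N * (\<Prod>m<N. 1 + q ^ m / x)"
    using assms prod.distrib[of "\<lambda>_. x" "\<lambda>m. 1 + q ^ m / x" "{..<N}"] by (simp add: distrib_left add.commute)
  ultimately show ?thesis using assms by simp
qed

end

section \<open>The bilateral theta series\<close>

lemma partial_theta_tri: "partial_theta q x = (\<Sum>j. q ^ tri j * x ^ j)"
  by (simp add: partial_theta_def tri_def)

lemma summable_norm_theta:
  fixes q x :: complex
  assumes "norm q < 1"
  shows "summable (\<lambda>j. norm (q ^ tri j * x ^ j))"
proof -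
  have "summable (\<lambda>j. complex_of_real (norm q) ^ (j * (j + 1) div 2) * of_real (norm x) ^ j)"
    using assms by (intro summable_partial_theta) simp
  then have "summable (\<lambda>j. complex_of_real (norm (q ^ tri j * x ^ j)))"
    by (simp add: norm_mult norm_power tri_def)
  then show ?thesis by (simp only: summable_of_real_iff)
qed

section \<open>From the finite products to the Jacobi triple product\<close>

lemma norm_less_1_power_Suc_neq_1:
  fixes q :: "'a::real_normed_div_algebra"
  assumes "norm q < 1"
  shows "q ^ Suc i \<noteq> 1"
proof
  assume "q ^ Suc i = 1"
  then have "norm q ^ Suc i = 1" by (metis norm_one norm_power)
  moreover have "norm q ^ Suc i \<le> norm q" using assms by (intro power_Suc_le_self) auto
  ultimately show False using assms by simp
qed

text \<open>The limit is Euler's product, which converges absolutely and has no zero factor. Because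
  it is nonzero, the reciprocals of \<open>qfact\<close> stay bounded as well.\<close>

lemma qfact_tendsto:
  fixes q :: complex
  assumes "norm q < 1"
  obtains L where "qfact q \<longlonglongrightarrow> L" "L \<noteq> 0"
proof -
  have "summable (\<lambda>i. norm ((1 - q ^ Suc i) - 1))"
    using assms by (simp add: norm_power norm_mult summable_mult del: power_Suc)
      (simp add: summable_geometric)
  then have "convergent_prod (\<lambda>i. 1 - q ^ Suc i)"
    by (intro abs_convergent_prod_imp_convergent_prod) (simp only: abs_convergent_prod_conv_summable)
  then obtain L where L: "(\<lambda>n. \<Prod>i\<le>n. 1 - q ^ Suc i) \<longlonglongrightarrow> L" "L \<noteq> 0"
    using norm_less_1_power_Suc_neq_1[OF assms]
    by (subst (asm) convergent_prod_iff_nz_lim) (auto simp del: power_Suc)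
  have "(\<Prod>i\<le>n. 1 - q ^ Suc i) = qfact q (Suc n)" for n
    by (induction n) (simp_all del: power_Suc add: mult.commute)
  then have "qfact q \<longlonglongrightarrow> L" using L(1) by (simp only: filterlim_sequentially_Suc)
  with L(2) show ?thesis by (rule that[rotated])
qed

text \<open>Tannery's theorem: after multiplication by \<open>qfact q N\<close> each coefficient is
  a product of two \<open>qfact\<close> values over a product of two others, so it is bounded and
  tends to L L / (L L) = 1. The shift s will be 0 for the nonnegative half and 1 for the negative
  half.\<close>

lemma jacobi_half_tendsto:
  fixes q x :: complex
  assumes q: "norm q < 1"
  shows "(\<lambda>N. qfact q N * (\<Sum>j\<le>N. qbin q (2 * N) (N + j + s) * q ^ tri j * x ^ j))
           \<longlonglongrightarrow> partial_theta q x"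
proof -
  obtain L where L: "qfact q \<longlonglongrightarrow> L" "L \<noteq> 0" using qfact_tendsto[OF q] .
  have nz: "qfact q n \<noteq> 0" for n
    using qfact_nonzero norm_less_1_power_Suc_neq_1[OF q] by blast
  have "Bseq (qfact q)" using L(1) by (intro convergent_imp_Bseq) (auto simp: convergent_def)
  then obtain C where C: "C > 0" "\<And>n. norm (qfact q n) \<le> C" by (auto elim: BseqE)
  have "Bseq (\<lambda>n. inverse (qfact q n))" using L
    by (intro convergent_imp_Bseq) (auto simp: convergent_def intro: tendsto_inverse)
  then obtain D where D: "D > 0" "\<And>n. norm (inverse (qfact q n)) \<le> D" by (auto elim: BseqE)
  \<comment> \<open>The cutoff at j > N turns the finite sum into a series in j. For j \<le> N < j +
    s the value is 0 as well, since the lower index of \<open>qbin\<close> exceeds 2N.\<close>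
  define c where "c j N = (if j \<le> N then qfact q N * qbin q (2 * N) (N + j + s) else 0)" for j N
  define a where "a j N = c j N * (q ^ tri j * x ^ j)" for j N
  have c_eq: "c j N = qfact q N * qfact q (2 * N) * inverse (qfact q (N + j + s))
                   * inverse (qfact q (N - (j + s)))" if "j + s \<le> N" for j N
    using that by (simp add: c_def qbin_def divide_inverse algebra_simps)
  have c_bound: "norm (c j N) \<le> C * C * D * D" for j N
  proof (cases "j + s \<le> N")
    case True
    then show ?thesis
      unfolding c_eq[OF True] norm_mult using C D by (intro mult_mono) (auto intro: less_imp_le)
  next
    case False
    then have "c j N = 0" by (auto simp: c_def qbin_eq_0)
    then show ?thesis using C D by (simp add: less_imp_le)
  qed
  have c_lim: "(\<lambda>N. c j N) \<longlonglongrightarrow> 1" for j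
  proof -
    have "filterlim (\<lambda>N. 2 * N) at_top (sequentially :: nat filter)"
      "filterlim (\<lambda>N. N + j + s) at_top (sequentially :: nat filter)"
      "filterlim (\<lambda>N. N - (j + s)) at_top (sequentially :: nat filter)"
      by real_asymp+
    note lims = this[THEN filterlim_compose[OF L(1)]]
    have "(\<lambda>N. qfact q N * qfact q (2 * N) * inverse (qfact q (N + j + s))
                   * inverse (qfact q (N - (j + s)))) \<longlonglongrightarrow> L * L * inverse L * inverse L"
      by (intro tendsto_intros lims L)
    moreover have "\<forall>\<^sub>F N in sequentially. qfact q N * qfact q (2 * N) * inverse (qfact q (N + j + s))
                   * inverse (qfact q (N - (j + s))) = c j N"
      using eventually_ge_at_top[of "j + s"] by eventually_elim (simp add: c_eq)
    ultimately show ?thesis using L(2) by (auto simp: field_simps dest: Lim_transform_eventually)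
  qed
  have "((\<lambda>N. suminf (\<lambda>j. a j N)) \<longlonglongrightarrow> suminf (\<lambda>j. q ^ tri j * x ^ j))"
  proof (rule tannerys_theorem[THEN conjunct2, THEN conjunct2])
    show "(\<lambda>N. a j N) \<longlonglongrightarrow> q ^ tri j * x ^ j" for j
      unfolding a_def using tendsto_mult[OF c_lim[of j] tendsto_const] by simp
    show "\<forall>\<^sub>F (j, N) in at_top \<times>\<^sub>F sequentially.
            norm (a j N) \<le> C * C * D * D * norm (q ^ tri j * x ^ j)"
      by (intro always_eventually) (auto simp: a_def norm_mult intro!: mult_right_mono c_bound)
    show "summable (\<lambda>j. C * C * D * D * norm (q ^ tri j * x ^ j))"
      by (intro summable_mult summable_norm_theta q)
  qed auto
  moreover have "suminf (\<lambda>j. a j N) =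
      qfact q N * (\<Sum>j\<le>N. qbin q (2 * N) (N + j + s) * q ^ tri j * x ^ j)" for N
    by (subst suminf_finite[of "{..N}"]) (auto simp: a_def c_def sum_distrib_left mult_ac)
  ultimately show ?thesis by (simp add: partial_theta_tri)
qed

text \<open>The sum of q^(j(j+1)/2) x^j over all integers j: with j = -(i+1) the exponent is
  \<open>tri i\<close> and the power of x is (1/x)^i / x.\<close>

definition full_theta :: "complex \<Rightarrow> complex \<Rightarrow> complex" where
  "full_theta q x = partial_theta q x + partial_theta q (1 / x) / x"

lemma jacobi_triple_product:
  fixes q x :: complex
  assumes q: "norm q < 1" and "x \<noteq> 0"
  shows "(\<lambda>N. qfact q N * ((\<Prod>m=1..N. 1 + x * q ^ m) * (\<Prod>m<N. 1 + q ^ m / x)))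
           \<longlonglongrightarrow> full_theta q x"
proof -
  have "qfact q N * ((\<Prod>m=1..N. 1 + x * q ^ m) * (\<Prod>m<N. 1 + q ^ m / x)) =
    qfact q N * (\<Sum>j\<le>N. qbin q (2 * N) (N + j + 0) * q ^ tri j * x ^ j) +
    qfact q N * (\<Sum>j\<le>N. qbin q (2 * N) (N + j + 1) * q ^ tri j * (1 / x) ^ j) / x" for N
  proof -
    \<comment> \<open>The negative half of the finite identity stops before N. Its extra term j = N
      vanishes because it carries the coefficient \<open>qbin q (2 * N) (2 * N + 1)\<close>.\<close>
    have "{..N} = insert N {..<N}" by auto
    then have "(\<Sum>j\<le>N. qbin q (2 * N) (N + j + 1) * q ^ tri j * (1 / x) ^ j) =
      (\<Sum>j<N. qbin q (2 * N) (N + Suc j) * q ^ tri j * (1 / x) ^ j)"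
      by (simp add: qbin_eq_0)
    then show ?thesis
      using finite_jacobi_triple_product[OF norm_less_1_power_Suc_neq_1[OF q] \<open>x \<noteq> 0\<close>, of N]
      by (simp add: distrib_left)
  qed
  then show ?thesis
    unfolding full_theta_def
    by (simp only:) (intro tendsto_add tendsto_divide tendsto_const jacobi_half_tendsto q \<open>x \<noteq> 0\<close>)
qed

section \<open>Functional equations and the size of the negative half\<close>

lemma partial_theta_0 [simp]: "partial_theta q 0 = 1"
  unfolding partial_theta_tri by (subst suminf_finite[of "{0}"]) auto

lemma partial_theta_shift:
  assumes "norm q < 1"
  shows "partial_theta q x = 1 + q * x * partial_theta q (q * x)"
proof -
  have s: "summable (\<lambda>j. q ^ tri j * y ^ j)" for y
    using summable_norm_theta[OF assms] by (rule summable_norm_cancel)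
  have "partial_theta q x = 1 + (\<Sum>j. q ^ tri (Suc j) * x ^ Suc j)"
    unfolding partial_theta_tri using suminf_split_head[OF s[of x]] by (simp del: tri_Suc power_Suc)
  also have "(\<lambda>j. q ^ tri (Suc j) * x ^ Suc j) = (\<lambda>j. q * x * (q ^ tri j * (q * x) ^ j))"
    by (auto simp: power_add power_mult_distrib mult_ac)
  also have "suminf \<dots> = q * x * partial_theta q (q * x)"
    unfolding partial_theta_tri using s by (rule suminf_mult)
  finally show ?thesis .
qed

lemma partial_theta_divide:
  assumes "norm q < 1" "q \<noteq> 0"
  shows "partial_theta q (x / q) = 1 + x * partial_theta q x"
  using partial_theta_shift[OF assms(1), of "x / q"] assms(2) by simp

lemma full_theta_divide:
  assumes "norm q < 1" "q \<noteq> 0" "x \<noteq> 0"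
  shows "full_theta q (x / q) = x * full_theta q x"
  using partial_theta_divide[OF assms(1,2), of x] partial_theta_shift[OF assms(1), of "1 / x"] assms
  by (simp add: full_theta_def field_simps)

text \<open>Iteration collects the factors x / q^i for i < n, whose product is (q x)^n / q^(tri n).
  The power \<open>q ^ tri n\<close> on the left avoids negative exponents.\<close>

lemma full_theta_divide_power:
  assumes "norm q < 1" "q \<noteq> 0" "x \<noteq> 0"
  shows "full_theta q (x / q ^ n) * q ^ tri n = (q * x) ^ n * full_theta q x"
proof (induction n)
  case (Suc n)
  have "full_theta q (x / q ^ Suc n) = x / q ^ n * full_theta q (x / q ^ n)"
    using full_theta_divide[of q "x / q ^ n"] assms by (simp add: mult.commute)
  then have "full_theta q (x / q ^ Suc n) * q ^ tri (Suc n) =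
             q * x * (full_theta q (x / q ^ n) * q ^ tri n)"
    using assms by (simp add: power_add)
  then show ?case using Suc by simp
qed simp

lemma norm_full_theta_divide_power:
  assumes "norm q < 1" "q \<noteq> 0" "x \<noteq> 0"
  shows "norm (full_theta q (x / q ^ n)) * norm q ^ tri n = (norm q * norm x) ^ n * norm (full_theta q x)"
  using arg_cong[OF full_theta_divide_power[OF assms, of n], of norm] by (simp add: norm_mult norm_power)

text \<open>The powers of q only shrink the terms, so a geometric series in 1/|x| dominates. This is
  the error in replacing \<theta> by \<Theta>.\<close>

lemma norm_partial_theta_inverse:
  assumes "norm q \<le> 1" "1 < norm x"
  shows "norm (partial_theta q (1 / x) / x) \<le> 1 / (norm x - 1)"
proof -
  have x0: "x \<noteq> 0" using assms(2) by (metis norm_zero not_one_less_zero)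
  have r: "norm (1 / x) < 1" using assms by (simp add: norm_divide divide_less_eq)
  have "norm (partial_theta q (1 / x)) \<le> (\<Sum>j. norm (1 / x) ^ j)"
    unfolding partial_theta_tri
  proof (rule norm_suminf_le)
    show "norm (q ^ tri n * (1 / x) ^ n) \<le> norm (1 / x) ^ n" for n
      unfolding norm_mult norm_power using assms
      by (intro mult_left_le_one_le) (auto intro: power_le_one)
    show "summable (\<lambda>j. norm (1 / x) ^ j)" using r by (intro summable_geometric) auto
  qed
  also have "\<dots> = 1 / (1 - norm (1 / x))"
    using r by (intro suminf_geometric) auto
  also have "\<dots> = norm x / (norm x - 1)" using assms(2) x0 by (simp add: norm_divide field_simps)
  finally have "norm (partial_theta q (1 / x)) / norm x \<le> norm x / (norm x - 1) / norm x"
    by (rule divide_right_mono) simp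
  then show ?thesis using x0 by (simp add: norm_divide)
qed

text \<open>Expand -ln (1 - t) into the sum of t^(k+1) / (k+1) and sum over A first. The assumed
  power sums bound the k-th term by c / (k+1)^2, and these add up to c \<pi>^2 / 6.\<close>

lemma prod_one_minus_ge_exp:
  fixes t :: "'a \<Rightarrow> real"
  assumes "finite A" and t: "\<And>m. m \<in> A \<Longrightarrow> 0 \<le> t m \<and> t m < 1"
    and c: "\<And>k. (\<Sum>m\<in>A. t m ^ Suc k) \<le> c / Suc k"
  shows "exp (- c * pi\<^sup>2 / 6) \<le> (\<Prod>m\<in>A. 1 - t m)"
proof -
  have ln: "(\<lambda>k. t m ^ Suc k / Suc k) sums (- ln (1 - t m))" if "m \<in> A" for m
  proof -
    have "(\<lambda>n. - ((- (- t m)) ^ n) / of_nat n) sums ln (1 + (- t m))"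
      using t[OF that] by (intro ln_series') auto
    \<comment> \<open>The term of index 0 is a division by 0 and hence 0; it is written out only so
      that the index can be shifted by one.\<close>
    from sums_minus[OF this] have "(\<lambda>n. t m ^ n / n) sums (- ln (1 - t m) + t m ^ 0 / real 0)"
      by simp
    then show ?thesis by (subst sums_Suc_iff)
  qed
  have sums: "(\<lambda>k. \<Sum>m\<in>A. t m ^ Suc k / Suc k) sums (\<Sum>m\<in>A. - ln (1 - t m))"
    by (intro sums_sum ln)
  have sums': "(\<lambda>k. c * (1 / (k + 1)\<^sup>2)) sums (c * (pi\<^sup>2 / 6))"
    using sums_mult[OF inverse_squares_sums, of c] by (simp add: add.commute)
  have "(\<Sum>m\<in>A. t m ^ Suc k / Suc k) \<le> c * (1 / (k + 1)\<^sup>2)" for k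
  proof -
    have "(\<Sum>m\<in>A. t m ^ Suc k / Suc k) \<le> c / Suc k / Suc k"
      unfolding sum_divide_distrib[symmetric] using c by (intro divide_right_mono) auto
    then show ?thesis by (simp add: power2_eq_square add.commute)
  qed
  then have "(\<Sum>m\<in>A. - ln (1 - t m)) \<le> c * (pi\<^sup>2 / 6)"
    by (rule sums_le[OF _ sums sums'])
  then have "exp (- c * pi\<^sup>2 / 6) \<le> exp (\<Sum>m\<in>A. ln (1 - t m))"
    by (simp add: sum_negf)
  also have "\<dots> = (\<Prod>m\<in>A. 1 - t m)"
    using t by (simp add: exp_sum[OF assms(1)] cong: prod.cong)
  finally show ?thesis .
qed

section \<open>Lower bounds for the bilateral series\<close>

text \<open>The difference vanishes at 0 and its derivative is a square. It serves to bound y / (1 -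
  y^2) = 1 / (2 sinh u) for y = e^(-u).\<close>

lemma le_sinh:
  fixes u :: real
  assumes "0 \<le> u"
  shows "2 * u \<le> exp u - exp (- u)"
proof -
  define h where "h u = exp u - exp (- u) - 2 * u" for u :: real
  have "h 0 \<le> h u"
  proof (rule DERIV_nonneg_imp_nondecreasing[OF assms])
    fix v :: real
    have "(h has_real_derivative exp v + exp (- v) - 2) (at v)"
      unfolding h_def by (auto intro!: derivative_eq_intros)
    moreover have "exp v + exp (- v) - 2 = (exp (v / 2) - exp (- v / 2))\<^sup>2"
      by (simp add: power2_diff flip: exp_add exp_double)
    ultimately show "\<exists>y. DERIV h v :> y \<and> 0 \<le> y" by force
  qed
  then show ?thesis by (simp add: h_def)
qed

text \<open>The power sums are geometric: with u = (k+1) \<tau> they are at most 1 / (e^u - 1) \<le>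
  1/u, so c = 1/\<tau> is admissible.\<close>

lemma prod_one_minus_exp_ge:
  assumes "0 < \<tau>"
  shows "exp (- pi\<^sup>2 / (6 * \<tau>)) \<le> (\<Prod>m=1..N. 1 - exp (- \<tau>) ^ m)"
proof -
  have "exp (- (1 / \<tau>) * pi\<^sup>2 / 6) \<le> (\<Prod>m=1..N. 1 - exp (- \<tau>) ^ m)"
  proof (rule prod_one_minus_ge_exp)
    fix k
    define u where "u = Suc k * \<tau>"
    define y where "y = exp (- u)"
    have "u > 0" using assms by (simp add: u_def)
    then have y: "0 < y" "y < 1" by (simp_all add: y_def)
    have "(exp (- \<tau>) ^ m) ^ Suc k = y ^ m" for m
      unfolding y_def u_def exp_of_nat_mult[symmetric] by (simp add: algebra_simps)
    then have "(\<Sum>m=1..N. (exp (- \<tau>) ^ m) ^ Suc k) = (\<Sum>m=1..N. y ^ m)" by simp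
    also have "\<dots> = y * (\<Sum>m<N. y ^ m)"
      unfolding sum_distrib_left
      by (rule sum.reindex_bij_witness[of _ Suc "\<lambda>m. m - 1"]) (auto simp flip: power_Suc)
    also have "(\<Sum>m<N. y ^ m) = (1 - y ^ N) / (1 - y)" using y by (subst sum_gp_strict) auto
    also have "\<dots> \<le> 1 / (1 - y)" using y by (intro divide_right_mono) auto
    also have "y * (1 / (1 - y)) \<le> 1 / u"
    proof -
      have "1 + u \<le> exp u" by (rule exp_ge_add_one_self)
      then have "(1 + u) * y \<le> 1" using mult_right_mono[of "1 + u" "exp u" y] y
        by (simp add: y_def flip: exp_add)
      then show ?thesis using y \<open>u > 0\<close> by (simp add: field_simps)
    qed
    finally show "(\<Sum>m=1..N. (exp (- \<tau>) ^ m) ^ Suc k) \<le> 1 / \<tau> / Suc k"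
      using y by (simp add: u_def mult.commute)
  qed (use assms in \<open>auto simp: power_less_one_iff\<close>)
  then show ?thesis by (simp add: mult.commute)
qed

text \<open>Here the power sums are at most 1 / (2 sinh u) \<le> 1 / (2u) with u = (k+1) \<tau> / 2.
  This leads to the same constant c = 1/\<tau> as the unshifted product.\<close>

lemma prod_one_minus_exp_odd_ge:
  assumes "0 < \<tau>"
  shows "exp (- pi\<^sup>2 / (6 * \<tau>)) \<le> (\<Prod>m<N. 1 - exp (- \<tau> / 2) * exp (- \<tau>) ^ m)"
proof -
  have "exp (- (1 / \<tau>) * pi\<^sup>2 / 6) \<le> (\<Prod>m<N. 1 - exp (- \<tau> / 2) * exp (- \<tau>) ^ m)"
  proof (rule prod_one_minus_ge_exp)
    fix k
    define u where "u = Suc k * \<tau> / 2"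
    define y where "y = exp (- u)"
    have "u > 0" using assms by (simp add: u_def)
    then have y: "0 < y" "y < 1" by (simp_all add: y_def)
    then have y2: "y\<^sup>2 < 1" by (simp add: power_less_one_iff)
    have "(exp (- \<tau> / 2) * exp (- \<tau>) ^ m) ^ Suc k = y * (y\<^sup>2) ^ m" for m
      unfolding y_def u_def exp_of_nat_mult[symmetric] exp_add[symmetric]
      by (simp add: algebra_simps add_divide_distrib)
    then have "(\<Sum>m<N. (exp (- \<tau> / 2) * exp (- \<tau>) ^ m) ^ Suc k) = y * (\<Sum>m<N. (y\<^sup>2) ^ m)"
      by (simp only: sum_distrib_left)
    also have "(\<Sum>m<N. (y\<^sup>2) ^ m) = (1 - (y\<^sup>2) ^ N) / (1 - y\<^sup>2)"
      using y2 by (subst sum_gp_strict) auto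
    also have "\<dots> \<le> 1 / (1 - y\<^sup>2)" using y y2 by (intro divide_right_mono) auto
    also have "y * (1 / (1 - y\<^sup>2)) \<le> 1 / (2 * u)"
    proof -
      have "2 * u \<le> exp u - exp (- u)" using le_sinh \<open>u > 0\<close> by simp
      then have "2 * u * y \<le> 1 - y\<^sup>2" using mult_right_mono[of "2 * u" "exp u - exp (- u)" y] y
        by (simp add: y_def left_diff_distrib power2_eq_square flip: exp_add)
      then show ?thesis using y y2 \<open>u > 0\<close> by (simp add: field_simps)
    qed
    finally show "(\<Sum>m<N. (exp (- \<tau> / 2) * exp (- \<tau>) ^ m) ^ Suc k) \<le> 1 / \<tau> / Suc k"
      using y by (simp add: u_def mult.commute)
  next
    fix m
    have "exp (- \<tau> / 2) * exp (- \<tau>) ^ m < 1 * 1"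
      using assms by (intro mult_less_le_imp_less) (auto simp: power_le_one)
    then show "0 \<le> exp (- \<tau> / 2) * exp (- \<tau>) ^ m \<and> exp (- \<tau> / 2) * exp (- \<tau>) ^ m < 1"
      by simp
  qed auto
  then show ?thesis by (simp add: mult.commute)
qed

section \<open>The bilateral series on circles between its zeros, and in the right
  half-plane\<close>

lemma norm_one_plus_ge: "1 - norm z \<le> norm (1 + z :: complex)"
  using norm_triangle_ineq2[of 1 "- z"] by simp

text \<open>The circle is the geometric mean of the zero circles |x| = 1 and |x| = 1/|q|. On it both
  x-dependent products are bounded below by the shifted product, so each of the three factors
  contributes exp (- \<pi>^2 / (6\<tau>)).\<close>

lemma norm_full_theta_ge_0:
  assumes "0 < \<tau>" "norm q = exp (- \<tau>)" "norm x = exp (\<tau> / 2)"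
  shows "exp (- pi\<^sup>2 / (2 * \<tau>)) \<le> norm (full_theta q x)"
proof (rule LIMSEQ_le_const)
  show "(\<lambda>N. norm (qfact q N * ((\<Prod>m=1..N. 1 + x * q ^ m) * (\<Prod>m<N. 1 + q ^ m / x))))
           \<longlonglongrightarrow> norm (full_theta q x)"
    using assms by (intro tendsto_norm jacobi_triple_product) auto
  have x: "1 - exp (- \<tau> / 2) * exp (- \<tau>) ^ m \<ge> 0" for m
    using assms by (simp add: power_le_one mult_le_one)
  have "exp (- pi\<^sup>2 / (2 * \<tau>)) \<le>
      norm (qfact q N * ((\<Prod>m=1..N. 1 + x * q ^ m) * (\<Prod>m<N. 1 + q ^ m / x)))" for N
  proof -
    define e where "e = exp (- pi\<^sup>2 / (6 * \<tau>))"
    have "e \<le> (\<Prod>m=1..N. 1 - exp (- \<tau>) ^ m)"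
      unfolding e_def by (rule prod_one_minus_exp_ge[OF assms(1)])
    also have "\<dots> \<le> norm (qfact q N)"
      unfolding qfact_def prod_norm[symmetric] using assms norm_one_plus_ge[of "- (q ^ _)"]
      by (intro prod_mono) (auto simp: norm_power power_le_one)
    finally have 1: "e \<le> norm (qfact q N)" .
    have "e \<le> (\<Prod>m<N. 1 - exp (- \<tau> / 2) * exp (- \<tau>) ^ m)"
      unfolding e_def by (rule prod_one_minus_exp_odd_ge[OF assms(1)])
    also have "\<dots> \<le> (\<Prod>m<N. norm (1 + x * q ^ Suc m))"
    proof (intro prod_mono conjI x)
      fix m
      have "exp (\<tau> / 2) * exp (- \<tau>) = exp (- \<tau> / 2)" by (simp flip: exp_add)
      then have "norm (x * q ^ Suc m) = exp (- \<tau> / 2) * exp (- \<tau>) ^ m"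
        using assms by (simp add: norm_mult norm_power)
      then show "1 - exp (- \<tau> / 2) * exp (- \<tau>) ^ m \<le> norm (1 + x * q ^ Suc m)"
        using norm_one_plus_ge by metis
    qed
    also have "\<dots> = norm (\<Prod>m=1..N. 1 + x * q ^ m)"
      unfolding prod_norm[symmetric]
      by (rule prod.reindex_bij_witness[of _ "\<lambda>m. m - 1" Suc]) auto
    finally have 2: "e \<le> norm (\<Prod>m=1..N. 1 + x * q ^ m)" .
    have "e \<le> (\<Prod>m<N. 1 - exp (- \<tau> / 2) * exp (- \<tau>) ^ m)"
      unfolding e_def by (rule prod_one_minus_exp_odd_ge[OF assms(1)])
    also have "\<dots> \<le> (\<Prod>m<N. norm (1 + q ^ m / x))"
    proof (intro prod_mono conjI x)
      fix m
      have "norm (q ^ m / x) = exp (- \<tau>) ^ m * inverse (exp (\<tau> / 2))"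
        unfolding norm_divide norm_power assms(2,3) by (rule divide_inverse)
      also have "inverse (exp (\<tau> / 2)) = exp (- \<tau> / 2)"
        by (simp flip: exp_minus)
      finally have "norm (q ^ m / x) = exp (- \<tau> / 2) * exp (- \<tau>) ^ m"
        by (simp only: mult.commute)
      then show "1 - exp (- \<tau> / 2) * exp (- \<tau>) ^ m \<le> norm (1 + q ^ m / x)"
        using norm_one_plus_ge by metis
    qed
    also have "\<dots> = norm (\<Prod>m<N. 1 + q ^ m / x)" by (simp add: prod_norm)
    finally have 3: "e \<le> norm (\<Prod>m<N. 1 + q ^ m / x)" .
    have "exp (- pi\<^sup>2 / (2 * \<tau>)) = e * (e * e)"
      using assms(1) by (simp add: e_def field_simps flip: exp_add)
    also have "\<dots> \<le> norm (qfact q N) * (norm (\<Prod>m=1..N. 1 + x * q ^ m) * norm (\<Prod>m<N. 1 + q ^ m / x))"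
      using 1 2 3 by (intro mult_mono) (auto simp: e_def)
    finally show ?thesis by (simp only: norm_mult)
  qed
  then show "\<exists>N. \<forall>n\<ge>N. exp (- pi\<^sup>2 / (2 * \<tau>)) \<le>
      norm (qfact q n * ((\<Prod>m=1..n. 1 + x * q ^ m) * (\<Prod>m<n. 1 + q ^ m / x)))" by blast
qed

text \<open>The functional equation carries the bound from the circle of index 0 to the n-th one;
  the gain in the exponent is \<tau> n(n+1)/2 - \<tau> n/2 = \<tau> n^2 / 2.\<close>

lemma norm_full_theta_ge:
  assumes "0 < \<tau>" "norm q = exp (- \<tau>)" "norm x = exp ((real n + 1 / 2) * \<tau>)"
  shows "exp (((real n * \<tau>)\<^sup>2 - pi\<^sup>2) / (2 * \<tau>)) \<le> norm (full_theta q x)"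
proof -
  have nz: "q \<noteq> 0" "x \<noteq> 0" using assms by auto
  have q1: "norm q < 1" using assms by simp
  define y where "y = x * q ^ n"
  have y: "norm y = exp (\<tau> / 2)"
    using assms by (simp add: y_def norm_mult norm_power algebra_simps flip: exp_of_nat_mult exp_add)
  have "y \<noteq> 0" "y / q ^ n = x" using nz by (simp_all add: y_def)
  with norm_full_theta_divide_power[OF q1 nz(1), of y n]
  have "norm (full_theta q x) * norm q ^ tri n = (norm q * norm y) ^ n * norm (full_theta q y)"
    by simp
  moreover have "norm q ^ tri n = exp (- (\<tau> * (real n * (real n + 1)) / 2))"
    unfolding of_nat_tri[symmetric] using assms by (simp add: mult.commute flip: exp_of_nat_mult)
  moreover have "(norm q * norm y) ^ n = exp (- (\<tau> * real n / 2))"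
    using assms y by (simp add: field_simps flip: exp_of_nat_mult exp_add)
  ultimately have eq: "norm (full_theta q x) * exp (- (\<tau> * (real n * (real n + 1)) / 2)) =
      exp (- (\<tau> * real n / 2)) * norm (full_theta q y)"
    by simp
  have "norm (full_theta q x) = norm (full_theta q x) * exp (- (\<tau> * (real n * (real n + 1)) / 2))
      * exp (\<tau> * (real n * (real n + 1)) / 2)"
    by (simp add: mult.assoc flip: exp_add)
  also have "\<dots> = exp (\<tau> * (real n)\<^sup>2 / 2) * norm (full_theta q y)"
    unfolding eq by (simp add: algebra_simps power2_eq_square add_divide_distrib flip: exp_add)
  also have "\<dots> \<ge> exp (\<tau> * (real n)\<^sup>2 / 2) * exp (- pi\<^sup>2 / (2 * \<tau>))"
    using norm_full_theta_ge_0[OF assms(1,2) y] by (intro mult_left_mono) auto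
  also have "exp (\<tau> * (real n)\<^sup>2 / 2) * exp (- pi\<^sup>2 / (2 * \<tau>)) =
      exp (((real n * \<tau>)\<^sup>2 - pi\<^sup>2) / (2 * \<tau>))"
    unfolding exp_add[symmetric] using assms(1) by (simp add: field_simps power2_eq_square)
  finally show ?thesis .
qed

text \<open>All terms are positive and the negative half only adds, so any single term is a lower
  bound.\<close>

lemma norm_full_theta_pos_ge:
  fixes q y :: real
  assumes "0 < q" "q < 1" "0 < y"
  shows "q ^ tri j * y ^ j \<le> norm (full_theta (of_real q) (of_real y))"
proof -
  define t where "t y = (\<Sum>j. q ^ tri j * y ^ j)" for y :: real
  have s: "summable (\<lambda>j. q ^ tri j * y ^ j)" if "y > 0" for y
  proof -
    have "summable (\<lambda>j. norm (complex_of_real q ^ tri j * of_real y ^ j))"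
      using assms by (intro summable_norm_theta) simp
    then show ?thesis using that assms by (simp add: norm_mult norm_power)
  qed
  have t: "partial_theta (of_real q) (of_real y) = of_real (t y)" if "y > 0" for y
    unfolding partial_theta_tri t_def using suminf_of_real[OF s[OF that], where ?'a = complex]
    by simp
  have "full_theta (of_real q) (of_real y) = of_real (t y + t (1 / y) / y)"
    using t[of y] t[of "1 / y"] assms(3) by (simp add: full_theta_def)
  then have "norm (full_theta (of_real q) (of_real y)) = \<bar>t y + t (1 / y) / y\<bar>"
    by (simp only: norm_of_real)
  moreover have "q ^ tri j * y ^ j \<le> t y"
    using sum_le_suminf[OF s[OF assms(3)], of "{j}"] assms by (simp add: t_def)
  moreover have "t (1 / y) \<ge> 0"
    unfolding t_def using s[of "1 / y"] assms by (intro suminf_nonneg) auto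
  ultimately show ?thesis using assms(3) by (smt (verit) divide_nonneg_pos)
qed

text \<open>Both x q^m and q^m / x have nonnegative real part, so every squared factor dominates the
  factor of the triple product at (q^2, |x|^2). The loss c comes from \<open>qfact\<close> at q,
  while \<open>qfact\<close> at q^2 has norm at most 1.\<close>

lemma norm_full_theta_right_halfplane_ge:
  assumes "0 < \<tau>" "norm x = exp L" "0 \<le> Re x" "0 \<le> L"
  shows "exp ((L\<^sup>2 - pi\<^sup>2 / 3) / \<tau> - L) \<le> (norm (full_theta (of_real (exp (- \<tau>))) x))\<^sup>2"
proof -
  define q where "q = exp (- \<tau>)"
  have q: "0 < q" "q < 1" using assms by (simp_all add: q_def)
  define c where "c = exp (- pi\<^sup>2 / (3 * \<tau>))"
  define y where "y = (norm x)\<^sup>2"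
  have x: "x \<noteq> 0" and y: "y > 0" using assms by (auto simp: y_def)
  have norm_one_plus: "1 + (norm z)\<^sup>2 \<le> (norm (1 + z))\<^sup>2" if "0 \<le> Re z" for z :: complex
    using that by (simp add: cmod_power2 power2_sum)
  have "c * norm (full_theta (of_real (q\<^sup>2)) (of_real y)) \<le> (norm (full_theta (of_real q) x))\<^sup>2"
  proof (rule LIMSEQ_le)
    show "(\<lambda>N. c * norm (qfact (of_real (q\<^sup>2)) N * ((\<Prod>m=1..N. 1 + of_real y * of_real (q\<^sup>2) ^ m) *
            (\<Prod>m<N. 1 + of_real (q\<^sup>2) ^ m / of_real y)) :: complex))
           \<longlonglongrightarrow> c * norm (full_theta (of_real (q\<^sup>2)) (of_real y))"
      using q y by (intro tendsto_norm tendsto_mult tendsto_const jacobi_triple_product)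
        (auto simp: power_less_one_iff norm_power)
    show "(\<lambda>N. (norm (qfact (of_real q) N * ((\<Prod>m=1..N. 1 + x * of_real q ^ m) *
            (\<Prod>m<N. 1 + of_real q ^ m / x))))\<^sup>2)
           \<longlonglongrightarrow> (norm (full_theta (of_real q) x))\<^sup>2"
      using q x by (intro tendsto_norm tendsto_power jacobi_triple_product) auto
    have "c * norm (qfact (of_real (q\<^sup>2)) N * ((\<Prod>m=1..N. 1 + of_real y * of_real (q\<^sup>2) ^ m) *
            (\<Prod>m<N. 1 + of_real (q\<^sup>2) ^ m / of_real y)) :: complex) \<le>
          (norm (qfact (of_real q) N * ((\<Prod>m=1..N. 1 + x * of_real q ^ m) *
            (\<Prod>m<N. 1 + of_real q ^ m / x))))\<^sup>2" for N
    proof -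
      have "norm (qfact (of_real (q\<^sup>2)) N :: complex) \<le> 1"
        unfolding qfact_def prod_norm[symmetric]
      proof (rule prod_le_1)
        fix m
        have "(1 - complex_of_real (q\<^sup>2) ^ m) = of_real (1 - (q\<^sup>2) ^ m)" by simp
        moreover have "(q\<^sup>2) ^ m \<le> 1" using q by (simp add: power_le_one)
        ultimately show "0 \<le> norm (1 - complex_of_real (q\<^sup>2) ^ m) \<and> norm (1 - complex_of_real (q\<^sup>2) ^ m) \<le> 1"
          by (simp only: norm_of_real) simp
      qed
      moreover have "c \<le> (norm (qfact (of_real q) N :: complex))\<^sup>2"
      proof -
        have "exp (- pi\<^sup>2 / (6 * \<tau>)) \<le> (\<Prod>m=1..N. 1 - q ^ m)"
          unfolding q_def by (rule prod_one_minus_exp_ge[OF assms(1)])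
        also have "\<dots> \<le> norm (qfact (of_real q) N :: complex)"
          unfolding qfact_def prod_norm[symmetric] using q norm_one_plus_ge[of "- (of_real q ^ _)"]
          by (intro prod_mono) (auto simp: norm_power power_le_one)
        finally have "exp (- pi\<^sup>2 / (6 * \<tau>)) ^ 2 \<le> (norm (qfact (of_real q) N :: complex))\<^sup>2"
          by (intro power_mono) auto
        then show ?thesis by (simp add: c_def flip: exp_double)
      qed
      ultimately have 1: "c * norm (qfact (of_real (q\<^sup>2)) N :: complex) \<le> (norm (qfact (of_real q) N :: complex))\<^sup>2 * 1"
        by (intro mult_mono) auto
      have 2: "norm (\<Prod>m=1..N. 1 + of_real y * of_real (q\<^sup>2) ^ m :: complex) \<le> (norm (\<Prod>m=1..N. 1 + x * of_real q ^ m))\<^sup>2"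
        unfolding prod_norm[symmetric] prod_power_distrib
      proof (intro prod_mono conjI)
        fix m
        have "norm (1 + of_real y * of_real (q\<^sup>2) ^ m :: complex) = norm (of_real (1 + y * (q\<^sup>2) ^ m) :: complex)" by simp
        also have "\<dots> = 1 + y * (q\<^sup>2) ^ m" unfolding norm_of_real using y q by simp
        also have "\<dots> = 1 + (norm (x * of_real q ^ m))\<^sup>2"
          using q by (simp add: y_def norm_mult norm_power power_mult_distrib flip: power_mult) (simp add: mult.commute)
        also have "\<dots> \<le> (norm (1 + x * of_real q ^ m))\<^sup>2"
          using assms(3) q by (intro norm_one_plus) (simp flip: of_real_power)
        finally show "norm (1 + of_real y * of_real (q\<^sup>2) ^ m :: complex) \<le> (norm (1 + x * of_real q ^ m))\<^sup>2" .
      qed simp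
      have 3: "norm (\<Prod>m<N. 1 + of_real (q\<^sup>2) ^ m / of_real y :: complex) \<le> (norm (\<Prod>m<N. 1 + of_real q ^ m / x))\<^sup>2"
        unfolding prod_norm[symmetric] prod_power_distrib
      proof (intro prod_mono conjI)
        fix m
        have "norm (1 + of_real (q\<^sup>2) ^ m / of_real y :: complex) = norm (of_real (1 + (q\<^sup>2) ^ m / y) :: complex)" by simp
        also have "\<dots> = 1 + (q\<^sup>2) ^ m / y" unfolding norm_of_real using y q by simp
        also have "\<dots> = 1 + (norm (of_real q ^ m / x))\<^sup>2"
          using q by (simp add: y_def norm_divide norm_power power_divide flip: power_mult) (simp add: mult.commute)
        also have "\<dots> \<le> (norm (1 + of_real q ^ m / x))\<^sup>2"
          using assms(3) q by (intro norm_one_plus) (simp add: Re_divide flip: of_real_power)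
        finally show "norm (1 + of_real (q\<^sup>2) ^ m / of_real y :: complex) \<le> (norm (1 + of_real q ^ m / x))\<^sup>2" .
      qed simp
      show ?thesis
        using mult_mono[OF 1 mult_mono[OF 2 3]] by (simp add: norm_mult power_mult_distrib mult.assoc)
    qed
    then show "\<exists>N0. \<forall>N\<ge>N0. c * norm (qfact (of_real (q\<^sup>2)) N * ((\<Prod>m=1..N. 1 + of_real y * of_real (q\<^sup>2) ^ m) *
            (\<Prod>m<N. 1 + of_real (q\<^sup>2) ^ m / of_real y)) :: complex) \<le>
          (norm (qfact (of_real q) N * ((\<Prod>m=1..N. 1 + x * of_real q ^ m) *
            (\<Prod>m<N. 1 + of_real q ^ m / x))))\<^sup>2" by blast
  qed
  moreover have "exp (L\<^sup>2 / \<tau> - L) \<le> norm (full_theta (of_real (q\<^sup>2)) (of_real y))"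
  proof -
    \<comment> \<open>This j picks the largest term of the positive series. The sign of (L -
      j\<tau>)((j+1)\<tau> - L) says exactly that its logarithm is at least L^2 / \<tau> -
      L.\<close>
    define j where "j = nat \<lfloor>L / \<tau>\<rfloor>"
    have "real j \<le> L / \<tau>" "L / \<tau> < real j + 1"
      using assms by (simp_all add: j_def of_nat_floor)
    then have "real j * \<tau> \<le> L" "L \<le> (real j + 1) * \<tau>"
      using assms(1) by (simp_all add: field_simps)
    then have "0 \<le> (L - real j * \<tau>) * ((real j + 1) * \<tau> - L)"
      by (intro mult_nonneg_nonneg) auto
    then have "L\<^sup>2 / \<tau> - L \<le> - \<tau> * (real j * (real j + 1)) + 2 * L * real j"
      using assms(1) by (simp add: field_simps power2_eq_square)
    then have "exp (L\<^sup>2 / \<tau> - L) \<le> exp (- \<tau> * (real j * (real j + 1)) + 2 * L * real j)" by simp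
    also have "\<dots> = (q\<^sup>2) ^ tri j * y ^ j"
      unfolding of_nat_tri[symmetric] y_def q_def assms(2)
      by (simp add: mult_ac flip: exp_of_nat_mult exp_add exp_double)
    also have "\<dots> \<le> norm (full_theta (of_real (q\<^sup>2)) (of_real y))"
      using q y by (intro norm_full_theta_pos_ge) (auto simp: power_less_one_iff)
    finally show ?thesis .
  qed
  ultimately have "c * exp (L\<^sup>2 / \<tau> - L) \<le> (norm (full_theta (of_real q) x))\<^sup>2"
    by (smt (verit) mult_left_mono c_def exp_gt_zero)
  moreover have "c * exp (L\<^sup>2 / \<tau> - L) = exp ((L\<^sup>2 - pi\<^sup>2 / 3) / \<tau> - L)"
    unfolding c_def exp_add[symmetric] using assms(1) by (simp add: diff_divide_distrib)
  ultimately show ?thesis by (simp add: q_def)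
qed

section \<open>Counting zeros\<close>

text \<open>Meaningful when the disc contains finitely many zeros, since a sum over an infinite set
  defaults to 0.\<close>

definition zero_count :: "(complex \<Rightarrow> complex) \<Rightarrow> real \<Rightarrow> int" where
  "zero_count f R = (\<Sum>p | norm p < R \<and> f p = 0. zorder f p)"

lemma finite_zeros_entire:
  assumes "f holomorphic_on UNIV" "f a \<noteq> 0"
  shows "finite {p. norm p < R \<and> f p = 0}"
proof (cases "\<exists>p. f p = 0")
  case True
  then have "\<not> f constant_on UNIV" using assms(2) unfolding constant_on_def by (metis UNIV_I)
  then have "finite {p \<in> cball 0 R. f p = 0}"
    using assms(1) by (intro holomorphic_compact_finite_zeros[of f UNIV]) auto
  then show ?thesis by (rule rev_finite_subset) auto
qed auto

text \<open>Rouche's theorem in winding number form, applied in the larger disc of radius 2R: the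
  circle winds once around the zeros inside it and not at all around those outside, and no zero lies
  on it.\<close>

lemma zero_count_Rouche:
  assumes hol: "f holomorphic_on UNIV" "g holomorphic_on UNIV" and "0 < R"
    and less: "\<And>z. norm z = R \<Longrightarrow> norm (g z) < norm (f z)"
  shows "zero_count (\<lambda>z. f z + g z) R = zero_count f R"
proof -
  let ?S = "ball 0 (2 * R) :: complex set" and ?\<gamma> = "circlepath 0 R"
  have img: "path_image ?\<gamma> = sphere 0 R" using \<open>0 < R\<close> by simp
  have nz: "f z \<noteq> 0" "f z + g z \<noteq> 0" if "norm z = R" for z
    using less[OF that] by (auto simp: add_eq_0_iff)
  have R: "norm (complex_of_real R) = R" using \<open>0 < R\<close> by simp
  have fin: "finite {p \<in> ?S. h p = 0}" if "h holomorphic_on UNIV" "h (of_real R) \<noteq> 0" for h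
    using finite_zeros_entire[OF that, of "2 * R"] by (simp add: conj_commute)
  have count: "(\<Sum>p\<in>{p \<in> ?S. h p = 0}. winding_number ?\<gamma> p * zorder h p) = zero_count h R"
    if h: "h holomorphic_on UNIV" "\<And>z. norm z = R \<Longrightarrow> h z \<noteq> 0" for h
  proof -
    have "(\<Sum>p\<in>{p \<in> ?S. h p = 0}. winding_number ?\<gamma> p * zorder h p) =
          (\<Sum>p | norm p < R \<and> h p = 0. winding_number ?\<gamma> p * zorder h p)"
    proof (rule sum.mono_neutral_right)
      show "finite {p \<in> ?S. h p = 0}" using h R by (intro fin) auto
      show "{p. norm p < R \<and> h p = 0} \<subseteq> {p \<in> ?S. h p = 0}" using \<open>0 < R\<close> by auto
      have outside: "winding_number ?\<gamma> p = 0" if "R < norm p" for p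
        using \<open>0 < R\<close> that by (intro winding_number_zero_outside[of _ "cball 0 R"]) auto
      show "\<forall>p\<in>{p \<in> ?S. h p = 0} - {p. norm p < R \<and> h p = 0}.
              winding_number ?\<gamma> p * zorder h p = 0"
      proof
        fix p assume "p \<in> {p \<in> ?S. h p = 0} - {p. norm p < R \<and> h p = 0}"
        then have "R < norm p" using h(2)[of p] by force
        then show "winding_number ?\<gamma> p * zorder h p = 0" by (simp add: outside)
      qed
    qed
    also have "\<dots> = (\<Sum>p | norm p < R \<and> h p = 0. of_int (zorder h p))"
      by (intro sum.cong refl) (auto simp: winding_number_circlepath)
    finally show ?thesis by (simp add: zero_count_def)
  qed
  have "(\<Sum>p\<in>{p \<in> ?S. f p + g p = 0}. winding_number ?\<gamma> p * zorder (\<lambda>p. f p + g p) p) =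
        (\<Sum>p\<in>{p \<in> ?S. f p = 0}. winding_number ?\<gamma> p * zorder f p)"
  proof (rule Rouche_theorem)
    show "finite {p \<in> ?S. f p + g p = 0}"
      using hol R nz by (intro fin holomorphic_intros) auto
    show "finite {p \<in> ?S. f p = 0}" using hol R nz by (intro fin) auto
    show "f holomorphic_on ?S" "g holomorphic_on ?S" using hol by (auto intro: holomorphic_on_subset)
    show "\<forall>z. z \<notin> ?S \<longrightarrow> winding_number ?\<gamma> z = 0"
      using \<open>0 < R\<close> by (intro allI impI winding_number_zero_outside[of _ "cball 0 R"]) auto
  qed (use less \<open>0 < R\<close> in auto)
  moreover have "(\<lambda>z. f z + g z) holomorphic_on UNIV" using hol by (intro holomorphic_intros)
  ultimately have "complex_of_int (zero_count (\<lambda>z. f z + g z) R) = of_int (zero_count f R)"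
    using count[of f] count[of "\<lambda>z. f z + g z"] hol nz by simp
  then show ?thesis by (simp only: of_int_eq_iff)
qed

section \<open>Zeros of the partial theta function in discs growing by the factor 1/|q|\<close>

lemma holomorphic_partial_theta:
  assumes "norm q < 1"
  shows "partial_theta q holomorphic_on A"
proof -
  have hol: "partial_theta q holomorphic_on ball 0 (norm z + 1)" for z
  proof (rule power_series_holomorphic)
    fix w
    show "(\<lambda>n. q ^ tri n * (w - 0) ^ n) sums partial_theta q w"
      using summable_norm_theta[OF assms, THEN summable_norm_cancel, THEN summable_sums]
      by (simp add: partial_theta_tri)
  qed
  have "partial_theta q field_differentiable at z" for z
    by (rule holomorphic_on_imp_differentiable_at[OF hol[of z] open_ball]) auto
  then show ?thesis
    by (auto simp: holomorphic_on_def intro: field_differentiable_at_within)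
qed

lemma holomorphic_partial_theta_compose:
  assumes "norm q < 1" "h holomorphic_on A"
  shows "(\<lambda>x. partial_theta q (h x)) holomorphic_on A"
  using holomorphic_on_compose[OF assms(2) holomorphic_partial_theta[OF assms(1)]]
  by (simp add: o_def)

context
  fixes q :: complex
  assumes norm_q: "norm q < 1" and q_nz: "q \<noteq> 0"
begin

lemma eventually_partial_theta_nonzero: "\<forall>\<^sub>F w in at z. partial_theta q w \<noteq> 0"
  using non_zero_neighbour_alt[OF holomorphic_partial_theta[OF norm_q] open_UNIV connected_UNIV, of z 0]
  by simp

lemma zorder_partial_theta_pos:
  assumes "partial_theta q z = 0"
  shows "zorder (partial_theta q) z > 0"
  using assms zorder_pos_iff[OF holomorphic_partial_theta[OF norm_q], of UNIV z]
    eventually_frequently[OF _ eventually_partial_theta_nonzero[of z]] by simp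

lemma finite_zeros_partial_theta: "finite {p. norm p < R \<and> partial_theta q p = 0}"
  using finite_zeros_entire[OF holomorphic_partial_theta[OF norm_q], of 0] by simp

text \<open>In \<theta>(x) = 1 + q x \<theta>(q x) the second summand dominates on |x| = r/|q|, so
  by Rouche it has as many zeros there as \<theta>. These are a simple zero at 0 and the points p/q
  for the zeros p of \<theta> with |p| < r.\<close>

lemma zero_count_shift:
  assumes r: "0 < r" and gt: "\<And>x. norm x = r \<Longrightarrow> 1 < norm (x * partial_theta q x)"
  shows "zero_count (partial_theta q) (r / norm q) = 1 + zero_count (partial_theta q) r"
proof -
  let ?\<theta> = "partial_theta q"
  define f where "f x = q * x * ?\<theta> (q * x)" for x
  have hol: "f holomorphic_on UNIV"
    unfolding f_def by (intro holomorphic_intros holomorphic_partial_theta_compose norm_q)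
  have "?\<theta> = (\<lambda>x. f x + 1)"
    unfolding f_def by (rule ext, subst partial_theta_shift[OF norm_q], rule add.commute)
  then have "zero_count ?\<theta> (r / norm q) = zero_count (\<lambda>x. f x + 1) (r / norm q)" by simp
  also have "\<dots> = zero_count f (r / norm q)"
  proof (rule zero_count_Rouche[OF hol])
    fix z :: complex assume "norm z = r / norm q"
    then have "norm (q * z) = r" using q_nz by (simp add: norm_mult)
    then show "norm (1 :: complex) < norm (f z)" using gt by (simp add: f_def)
  qed (use r q_nz in auto)
  also have "\<dots> = 1 + zero_count ?\<theta> r"
  proof -
    have set_eq: "{p. norm p < r / norm q \<and> f p = 0} =
          insert 0 ((\<lambda>p. p / q) ` {p. norm p < r \<and> ?\<theta> p = 0})" (is "_ = insert 0 (_ ` ?Z)")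
    proof (intro equalityI subsetI)
      fix p assume "p \<in> {p. norm p < r / norm q \<and> f p = 0}"
      then have "p = 0 \<or> q * p \<in> ?Z \<and> p = q * p / q"
        using q_nz by (auto simp: f_def norm_mult field_simps)
      then show "p \<in> insert 0 ((\<lambda>p. p / q) ` ?Z)" by blast
    next
      fix p assume "p \<in> insert 0 ((\<lambda>p. p / q) ` ?Z)"
      then show "p \<in> {p. norm p < r / norm q \<and> f p = 0}"
        using q_nz r by (auto simp: f_def norm_divide divide_strict_right_mono)
    qed
    have ana: "(\<lambda>x. q * x) analytic_on {z}" "(\<lambda>x. ?\<theta> (q * x)) analytic_on {z}" for z
    proof -
      show "(\<lambda>x. q * x) analytic_on {z}" by (intro analytic_intros)
      have "(\<lambda>x. ?\<theta> (q * x)) holomorphic_on UNIV"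
        by (intro holomorphic_intros holomorphic_partial_theta_compose norm_q)
      then show "(\<lambda>x. ?\<theta> (q * x)) analytic_on {z}"
        using analytic_on_open analytic_on_subset open_UNIV by blast
    qed
    have ev: "\<forall>\<^sub>F w in at z. f w \<noteq> 0" for z
    proof -
      \<comment> \<open>A point on the circle, where f cannot vanish; so f is not identically zero
        and its zeros are isolated.\<close>
      define b where "b = complex_of_real (r / norm q)"
      have "norm (q * b) = r" using r q_nz by (simp add: b_def norm_mult norm_divide)
      from gt[OF this] have "f b \<noteq> 0" by (auto simp: f_def)
      from non_zero_neighbour_alt[OF hol open_UNIV connected_UNIV UNIV_I UNIV_I this]
      show ?thesis by simp
    qed
    have split: "zorder f z = zorder (\<lambda>x. q * x) z + zorder (\<lambda>x. ?\<theta> (q * x)) z" for z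
      unfolding f_def using ev[of z] by (intro zorder_times_analytic ana) (simp add: f_def)
    have at_0: "zorder f 0 = 1"
    proof -
      have "zorder (\<lambda>x. q * x) 0 = 1"
        using q_nz by (intro zorder_eqI[of UNIV _ "\<lambda>_. q"]) (auto intro: holomorphic_intros)
      moreover have "zorder (\<lambda>x. ?\<theta> (q * x)) 0 = 0"
        by (intro zorder_eq_0I ana) simp
      ultimately show ?thesis by (simp add: split)
    qed
    have at_p: "zorder f (p / q) = zorder ?\<theta> p" if "p \<in> ?Z" for p
    proof -
      have "p \<noteq> 0" using that by auto
      then have "zorder (\<lambda>x. q * x) (p / q) = 0"
        using q_nz by (intro zorder_eq_0I ana) auto
      moreover have "?\<theta> analytic_on UNIV"
        by (simp add: analytic_on_open holomorphic_partial_theta norm_q)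
      then have "?\<theta> analytic_on {q * (p / q)}" by (rule analytic_on_subset) simp
      then have "zorder (\<lambda>x. ?\<theta> (q * x)) (p / q) = zorder ?\<theta> (q * (p / q))"
        using q_nz by (intro zorder_scale analytic_on_imp_meromorphic_on)
      ultimately show ?thesis using q_nz by (simp add: split)
    qed
    \<comment> \<open>The point 0 is not among the p/q because \<theta>(0) = 1, so its order is
      counted separately.\<close>
    have "zero_count f (r / norm q) = zorder f 0 + (\<Sum>p\<in>(\<lambda>p. p / q) ` ?Z. zorder f p)"
      unfolding zero_count_def set_eq using finite_zeros_partial_theta q_nz
      by (subst sum.insert) auto
    also have "(\<Sum>p\<in>(\<lambda>p. p / q) ` ?Z. zorder f p) = (\<Sum>p\<in>?Z. zorder f (p / q))"
      using q_nz by (subst sum.reindex) (auto simp: inj_on_def)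
    also have "\<dots> = zero_count ?\<theta> r"
      unfolding zero_count_def using at_p by (intro sum.cong) auto
    finally show ?thesis by (simp add: at_0)
  qed
  finally show ?thesis .
qed

end

text \<open>The larger disc has only one zero more, counted with multiplicity, whereas a non-real
  zero in the annulus would bring its conjugate along.\<close>

lemma zero_in_annulus_real:
  fixes q :: real
  assumes q: "\<bar>q\<bar> < 1" "q \<noteq> 0" and r: "0 < r"
    and gt: "\<And>x. norm x = r \<Longrightarrow> 1 < norm (x * partial_theta (of_real q) x)"
    and z: "partial_theta (of_real q) z = 0" "r \<le> norm z" "norm z < r / \<bar>q\<bar>"
  shows "Im z = 0"
proof (rule ccontr)
  assume "Im z \<noteq> 0"
  then have neq: "z \<noteq> cnj z" by (metis Im_complex_of_real Reals_cases Reals_cnj_iff)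
  let ?\<theta> = "partial_theta (of_real q)"
  let ?Z = "\<lambda>R. {p. norm p < R \<and> ?\<theta> p = 0}"
  have nq: "norm (complex_of_real q) < 1" and q0: "complex_of_real q \<noteq> 0" using q by auto
  have cz: "?\<theta> (cnj z) = 0" using z(1) partial_theta_of_real_cnj[OF q(1)] by simp
  have "r < r / \<bar>q\<bar>" using q r by (simp add: less_divide_eq)
  then have sub: "insert z (insert (cnj z) (?Z r)) \<subseteq> ?Z (r / \<bar>q\<bar>)"
    using z cz by auto
  have pos: "0 < zorder ?\<theta> p" if "?\<theta> p = 0" for p
    by (rule zorder_partial_theta_pos[OF nq q0 that])
  have "zorder ?\<theta> z + (zorder ?\<theta> (cnj z) + zero_count ?\<theta> r) =
        (\<Sum>p\<in>insert z (insert (cnj z) (?Z r)). zorder ?\<theta> p)"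
    unfolding zero_count_def using finite_zeros_partial_theta[OF nq q0] neq z(2)
    by (subst sum.insert, simp_all)
  also have "\<dots> \<le> zero_count ?\<theta> (r / \<bar>q\<bar>)"
    unfolding zero_count_def using finite_zeros_partial_theta[OF nq q0] sub pos
    by (intro sum_mono2) (auto intro: less_imp_le)
  also have "\<dots> = 1 + zero_count ?\<theta> r"
    using zero_count_shift[OF nq q0 r gt] by simp
  finally show False using pos[OF z(1)] pos[OF cz] by simp
qed

text \<open>The constant 4/3 reproduces itself: |y \<theta>(y)| \<ge> 4/3 gives |\<theta>(y/q)|
  \<ge> 1/3, and |y/q| \<ge> 4 restores 4/3. Hence every annulus beyond r is covered.\<close>

lemma large_zeros_real:
  fixes q :: real
  assumes q: "\<bar>q\<bar> < 1" "q \<noteq> 0" and r: "0 < r" "4 \<le> r / \<bar>q\<bar>"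
    and ge: "\<And>x. norm x = r \<Longrightarrow> 4 / 3 \<le> norm (x * partial_theta (of_real q) x)"
    and z: "partial_theta (of_real q) z = 0" "r \<le> norm z"
  shows "Im z = 0"
proof -
  let ?\<theta> = "partial_theta (of_real q)"
  have nq: "norm (complex_of_real q) < 1" and q0: "complex_of_real q \<noteq> 0" using q by auto
  have ge': "4 / 3 \<le> norm (x * ?\<theta> x)" if "norm x = r / \<bar>q\<bar> ^ k" for k x
    using that
  proof (induction k arbitrary: x)
    case (Suc k)
    define y where "y = q * x"
    have x: "x = y / q" using q by (simp add: y_def)
    have "norm y = r / \<bar>q\<bar> ^ k" using Suc.prems q by (simp add: y_def norm_mult field_simps)
    from Suc.IH[OF this] have "4 / 3 \<le> norm (y * ?\<theta> y)" .
    then have "1 / 3 \<le> norm (?\<theta> x)"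
      unfolding x partial_theta_divide[OF nq q0] using norm_triangle_ineq2[of "y * ?\<theta> y" "- 1"]
      by (simp add: add.commute)
    moreover have "4 \<le> norm x"
    proof -
      have "\<bar>q\<bar> ^ Suc k \<le> \<bar>q\<bar>" using q by (simp add: power_le_one mult_left_le)
      then have "r / \<bar>q\<bar> \<le> r / \<bar>q\<bar> ^ Suc k" using q r by (intro divide_left_mono) auto
      then show ?thesis using r Suc.prems by linarith
    qed
    ultimately have "4 * (1 / 3) \<le> norm x * norm (?\<theta> x)" by (intro mult_mono) auto
    then show ?case by (simp add: norm_mult)
  qed (use ge in simp)
  have "\<exists>k. norm z < r / \<bar>q\<bar> ^ k"
  proof -
    have "0 < norm z" using r z(2) by linarith
    moreover from this obtain k where "\<bar>q\<bar> ^ k < r / norm z"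
      using real_arch_pow_inv[of "r / norm z" "\<bar>q\<bar>"] q r by auto
    ultimately show ?thesis using q by (auto simp: field_simps intro!: exI[of _ k])
  qed
  \<comment> \<open>The least such k is positive because r \<le> |z|, so z lies between the circles
    of index k - 1 and k.\<close>
  then obtain k where k: "norm z < r / \<bar>q\<bar> ^ k" "\<forall>i<k. \<not> norm z < r / \<bar>q\<bar> ^ i"
    using exists_least_iff[of "\<lambda>k. norm z < r / \<bar>q\<bar> ^ k"] by blast
  with z(2) obtain m where m: "k = Suc m" by (cases k) auto
  show ?thesis
  proof (rule zero_in_annulus_real[OF q _ _ z(1)])
    show "0 < r / \<bar>q\<bar> ^ m" using q r by simp
    show "1 < norm (x * ?\<theta> x)" if "norm x = r / \<bar>q\<bar> ^ m" for x
      using ge'[OF that] by simp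
    show "r / \<bar>q\<bar> ^ m \<le> norm z" "norm z < r / \<bar>q\<bar> ^ m / \<bar>q\<bar>"
      using k m by (auto simp: mult.commute not_less)
  qed
qed

section \<open>Location of the non-real zeros\<close>

text \<open>With p the square root of |q| we have |q x| \<le> p, so the j-th term of \<theta>(q x)
  is at most p^(2 tri j + j) \<le> p^(3j).\<close>

lemma norm_partial_theta_minus_1:
  assumes p: "0 < p" "p < 1" and q: "norm q = p\<^sup>2" and x: "norm x \<le> 1 / p"
  shows "norm (partial_theta q x - 1) \<le> p / (1 - p ^ 3)"
proof -
  have q1: "norm q < 1" using p q by (simp add: power_less_one_iff)
  have p3: "p ^ 3 < 1" using p by (simp add: power_less_one_iff)
  have "p * norm x \<le> 1" using p x by (simp add: field_simps)
  then have "p * (p * norm x) \<le> p * 1" using p by (intro mult_left_mono) auto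
  then have qx: "norm (q * x) \<le> p"
    by (simp add: norm_mult q power2_eq_square mult.assoc)
  have "norm (partial_theta q (q * x)) \<le> (\<Sum>j. (p ^ 3) ^ j)"
    unfolding partial_theta_tri
  proof (rule norm_suminf_le)
    fix j
    have "norm (q ^ tri j * (q * x) ^ j) \<le> (p\<^sup>2) ^ tri j * p ^ j"
      unfolding norm_mult[of "q ^ tri j"] norm_power q
      using qx p by (intro mult_left_mono power_mono) auto
    also have "\<dots> = p ^ (2 * tri j + j)" by (simp add: power_add power_mult)
    also have "\<dots> \<le> p ^ (3 * j)"
      using p le_tri[of j] by (intro power_decreasing) auto
    finally show "norm (q ^ tri j * (q * x) ^ j) \<le> (p ^ 3) ^ j" by (simp add: power_mult)
    show "summable (\<lambda>j. (p ^ 3) ^ j)" using p p3 by (intro summable_geometric) auto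
  qed
  also have "\<dots> = 1 / (1 - p ^ 3)" using p p3 by (intro suminf_geometric) auto
  finally have "norm (q * x) * norm (partial_theta q (q * x)) \<le> p * (1 / (1 - p ^ 3))"
    using qx p by (intro mult_mono) auto
  moreover have "partial_theta q x - 1 = q * x * partial_theta q (q * x)"
    by (subst partial_theta_shift[OF q1]) simp
  ultimately show ?thesis by (simp add: norm_mult)
qed

text \<open>Inside the circle |x| = 1/p the function stays too close to 1 to vanish; this circle
  also starts the chain of annuli for the zeros outside.\<close>

lemma zeros_real_if_small:
  fixes q :: real
  assumes q: "q \<noteq> 0" "\<bar>q\<bar> \<le> 1 / 6" and z: "partial_theta (of_real q) z = 0"
  shows "Im z = 0"
proof -
  define p where "p = sqrt \<bar>q\<bar>"
  have p2: "p\<^sup>2 = \<bar>q\<bar>" by (simp add: p_def)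
  have "p > 0" using q by (simp add: p_def)
  \<comment> \<open>0.409 slightly exceeds the square root of 1/6; its cube is below 0.07, whence
    the 93/100.\<close>
  have "p\<^sup>2 < (409 / 1000)\<^sup>2" unfolding p2 using q by (simp add: power2_eq_square)
  then have p: "p < 409 / 1000" by (rule power_less_imp_less_base) simp
  have "p ^ 3 \<le> (409 / 1000) ^ 3" using p \<open>p > 0\<close> by (intro power_mono) auto
  then have "93 / 100 \<le> 1 - p ^ 3" by (simp add: power3_eq_cube)
  then have "p / (1 - p ^ 3) \<le> p / (93 / 100)"
    using \<open>p > 0\<close> by (intro divide_left_mono) auto
  then have ge: "1 - p * (100 / 93) \<le> norm (partial_theta (of_real q) x)" if "norm x \<le> 1 / p" for x
  proof -
    have "norm (partial_theta (of_real q) x - 1) \<le> p / (1 - p ^ 3)"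
      using that p \<open>p > 0\<close> p2 by (intro norm_partial_theta_minus_1) auto
    moreover have "1 - norm (partial_theta (of_real q) x - 1) \<le> norm (partial_theta (of_real q) x)"
      using norm_triangle_ineq2[of 1 "1 - partial_theta (of_real q) x"] by (simp add: norm_minus_commute)
    moreover have "p / (1 - p ^ 3) \<le> p * (100 / 93)"
      using \<open>p / (1 - p ^ 3) \<le> p / (93 / 100)\<close> by simp
    ultimately show ?thesis by (smt (verit))
  qed
  show ?thesis
  proof (cases "norm z < 1 / p")
    case True
    then show ?thesis using ge[of z] z p by simp
  next
    case False
    show ?thesis
    proof (rule large_zeros_real)
      show "4 \<le> 1 / p / \<bar>q\<bar>"
      proof -
        have "p * \<bar>q\<bar> \<le> 1 / 2 * (1 / 6)" using p q \<open>p > 0\<close> by (intro mult_mono) auto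
        then show ?thesis using p q \<open>p > 0\<close> by (simp add: field_simps)
      qed
      fix x :: complex assume x: "norm x = 1 / p"
      \<comment> \<open>For p < 0.409 the right side, 1/p - 100/93, is above 1.36.\<close>
      have "4 / 3 \<le> 1 / p * (1 - p * (100 / 93))"
        using p \<open>p > 0\<close> by (simp add: field_simps)
      also have "\<dots> \<le> norm x * norm (partial_theta (of_real q) x)"
        unfolding x using ge[of x] x \<open>p > 0\<close> by (intro mult_left_mono) auto
      finally show "4 / 3 \<le> norm (x * partial_theta (of_real q) x)" by (simp add: norm_mult)
    qed (use q z False \<open>p > 0\<close> in auto)
  qed
qed

text \<open>Raising to the n-th power reduces exp (m/n) to e^m with 2.71 < e < 2.72. In order: the
  outer radius, the range of \<tau>, the lower bound 1/5 for |\<Theta>|, the least radius of the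
  chosen circle, and the threshold in the right half-plane.\<close>

lemma exp_numeral_bounds:
  "exp (24 / 5) < (132 :: real)" "6 < exp (9 / 5 :: real)" "exp (8 / 5) < (5 :: real)"
  "19 < exp (3 :: real)" "exp 2 < (18 :: real)"
proof -
  have e: "exp 1 < (272 / 100 :: real)" "271 / 100 < (exp 1 :: real)"
    using e_less_272 e_approx_32 by (auto simp: abs_if split: if_splits)
  have exp_pow: "exp x ^ n = exp (1 :: real) ^ m" if "real n * x = real m" for n m x
    using that by (simp flip: exp_of_nat_mult)
  have less: "exp x < c" if "real n * x = real m" "(272 / 100) ^ m < c ^ n" "0 \<le> c" for c x and n m
  proof -
    have "exp x ^ n \<le> (272 / 100) ^ m"
      unfolding exp_pow[OF that(1)] using e by (intro power_mono) auto
    then have "exp x ^ n < c ^ n" using that(2) by (rule le_less_trans)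
    then show ?thesis using that(3) by (rule power_less_imp_less_base)
  qed
  have greater: "c < exp x" if "real n * x = real m" "c ^ n < (271 / 100) ^ m" for c x and n m
  proof -
    have "(271 / 100) ^ m \<le> exp x ^ n"
      unfolding exp_pow[OF that(1)] using e by (intro power_mono) auto
    with that(2) have "c ^ n < exp x ^ n" by (rule less_le_trans)
    then show ?thesis by (rule power_less_imp_less_base) simp
  qed
  show "exp (24 / 5) < (132 :: real)" by (rule less[of 5 _ 24]) (simp_all add: power_divide)
  show "6 < exp (9 / 5 :: real)" by (rule greater[of 5 _ 9]) (simp_all add: power_divide)
  show "exp (8 / 5) < (5 :: real)" by (rule less[of 5 _ 8]) (simp_all add: power_divide)
  show "19 < exp (3 :: real)" by (rule greater[of 1 _ 3]) (simp_all add: power_divide)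
  show "exp 2 < (18 :: real)" by (rule less[of 1 _ 2]) (simp_all add: power_divide)
qed

lemma pi_squared_less: "pi\<^sup>2 < 987 / 100"
proof -
  have "pi\<^sup>2 \<le> (3.1415926535899)\<^sup>2" using pi_approx by (intro power_mono) auto
  also have "\<dots> < 987 / 100" by (simp add: power2_eq_square)
  finally show ?thesis .
qed

lemma norm_partial_theta_ge:
  assumes "norm q \<le> 1" "1 < norm x"
  shows "norm (full_theta q x) - 1 / (norm x - 1) \<le> norm (partial_theta q x)"
  using norm_partial_theta_inverse[OF assms]
    norm_triangle_ineq[of "partial_theta q x" "partial_theta q (1 / x) / x"]
  by (simp add: full_theta_def)

text \<open>For |q| > 1/6 the circles with radii exp ((n + 1/2) \<tau>) are dense enough for one to
  have radius between 19 and 132. There |\<Theta>| \<ge> 1/5, which outweighs the negative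
  half.\<close>

lemma norm_nonreal_zero_less_132:
  fixes q :: real
  assumes q: "q \<noteq> 0" "\<bar>q\<bar> < 1" and z: "partial_theta (of_real q) z = 0" "Im z \<noteq> 0"
  shows "norm z < 132"
proof -
  have "1 / 6 < \<bar>q\<bar>" using zeros_real_if_small[OF q(1) _ z(1)] z(2) by force
  define \<tau> where "\<tau> = - ln \<bar>q\<bar>"
  have q_eq: "\<bar>q\<bar> = exp (- \<tau>)" using q by (simp add: \<tau>_def)
  have "0 < \<tau>" using q by (simp add: \<tau>_def ln_less_zero)
  have "exp \<tau> < exp (9 / 5)"
  proof -
    have "exp \<tau> < 6"
      using \<open>1 / 6 < \<bar>q\<bar>\<close> unfolding q_eq by (simp add: exp_minus field_simps)
    then show ?thesis using exp_numeral_bounds(2) by linarith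
  qed
  then have "\<tau> < 9 / 5" by simp
  \<comment> \<open>The largest n with (n + 1/2) \<tau> \<le> 24/5. The floor is taken of a
    nonnegative number, so \<open>nat\<close> does not truncate.\<close>
  define n where "n = nat \<lfloor>24 / 5 / \<tau> - 1 / 2\<rfloor>"
  have "1 / 2 \<le> 24 / 5 / \<tau>" using \<open>0 < \<tau>\<close> \<open>\<tau> < 9 / 5\<close> by (simp add: field_simps)
  then have "real n \<le> 24 / 5 / \<tau> - 1 / 2" "24 / 5 / \<tau> - 1 / 2 < real n + 1"
    by (simp_all add: n_def of_nat_floor)
  then have n: "(real n + 1 / 2) * \<tau> \<le> 24 / 5" "24 / 5 < (real n + 3 / 2) * \<tau>"
    using \<open>0 < \<tau>\<close> by (simp_all add: field_simps)
  define r where "r = exp ((real n + 1 / 2) * \<tau>)"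
  have "r \<le> exp (24 / 5)" unfolding r_def using n(1) by (simp only: exp_le_cancel_iff)
  then have "r < 132" using exp_numeral_bounds(1) by linarith
  \<comment> \<open>By maximality of n, (n + 1/2) \<tau> > 24/5 - \<tau> > 24/5 - 9/5 = 3.\<close>
  have "exp 3 \<le> r" unfolding r_def using n(2) \<open>\<tau> < 9 / 5\<close> by (simp add: algebra_simps)
  then have "19 < r" using exp_numeral_bounds(4) by simp
  have ge: "4 / 3 \<le> norm (x * partial_theta (of_real q) x)" if x: "norm x = r" for x
  proof -
    have "(24 / 5 - 3 / 2 * \<tau>)\<^sup>2 \<le> (real n * \<tau>)\<^sup>2"
      using n(2) \<open>\<tau> < 9 / 5\<close> by (intro power_mono) (auto simp: algebra_simps)
    \<comment> \<open>9.87 stands for \<pi>^2, and 16/5 becomes the exponent -8/5 after division by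
      2\<tau>. Splitting off a square centred at 9/5 leaves a linear rest that is at least 0.3 for
      \<tau> < 9/5.\<close>
    moreover have "987 / 100 - 16 / 5 * \<tau> \<le> (24 / 5 - 3 / 2 * \<tau>)\<^sup>2"
    proof -
      have "(24 / 5 - 3 / 2 * \<tau>)\<^sup>2 - (987 / 100 - 16 / 5 * \<tau>) =
            9 / 4 * (9 / 5 - \<tau>)\<^sup>2 + (588 / 100 - 31 / 10 * \<tau>)"
        by (simp add: power2_eq_square field_simps)
      moreover have "\<dots> \<ge> 0" using \<open>\<tau> < 9 / 5\<close> by (intro add_nonneg_nonneg) auto
      ultimately show ?thesis by linarith
    qed
    ultimately have "- (16 / 5 * \<tau>) \<le> (real n * \<tau>)\<^sup>2 - pi\<^sup>2" using pi_squared_less by linarith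
    then have exponent: "- (8 / 5) \<le> ((real n * \<tau>)\<^sup>2 - pi\<^sup>2) / (2 * \<tau>)"
      using \<open>0 < \<tau>\<close> by (simp add: field_simps)
    have "1 / 5 \<le> exp (- (8 / 5) :: real)"
      using exp_numeral_bounds(3) by (simp add: exp_minus field_simps)
    also have "exp (- (8 / 5)) \<le> exp (((real n * \<tau>)\<^sup>2 - pi\<^sup>2) / (2 * \<tau>))"
      using exponent by simp
    also have "\<dots> \<le> norm (full_theta (of_real q) x)"
      using \<open>0 < \<tau>\<close> q_eq x by (intro norm_full_theta_ge) (auto simp: r_def)
    finally have "1 / 5 \<le> norm (full_theta (of_real q) x)" .
    moreover have "1 / (norm x - 1) \<le> 1 / 18" using x \<open>19 < r\<close> by (simp add: field_simps)
    moreover have "norm (full_theta (of_real q) x) - 1 / (norm x - 1) \<le>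
        norm (partial_theta (of_real q) x)"
      using q x \<open>19 < r\<close> by (intro norm_partial_theta_ge) auto
    ultimately have "1 / 5 - 1 / 18 \<le> norm (partial_theta (of_real q) x)"
      by linarith
    \<comment> \<open>The left side is 247/90, well above 4/3.\<close>
    then have "19 * (1 / 5 - 1 / 18) \<le> norm x * norm (partial_theta (of_real q) x)"
      using x \<open>19 < r\<close> by (intro mult_mono) auto
    then show ?thesis by (simp add: norm_mult)
  qed
  have "4 \<le> r / \<bar>q\<bar>" using \<open>19 < r\<close> q by (simp add: field_simps)
  have "norm z < r"
  proof (rule ccontr)
    assume "\<not> norm z < r"
    then have "Im z = 0"
      using \<open>19 < r\<close> \<open>4 \<le> r / \<bar>q\<bar>\<close> by (intro large_zeros_real[OF q(2,1) _ _ ge z(1)]) (simp_all add: not_less)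
    with z(2) show False by simp
  qed
  with \<open>r < 132\<close> show ?thesis by simp
qed

text \<open>At a zero \<Theta> reduces to its negative half, so |\<Theta>|^2 \<le> 1 / (|x| - 1)^2.
  The half-plane bound gives |\<Theta>|^2 \<ge> 1/|x|, and (|x| - 1)^2 \<le> |x| fails for |x| \<ge>
  18.\<close>

lemma no_zeros_right_halfplane:
  fixes q :: real
  assumes q: "0 < q" "q < 1" and x: "0 \<le> Re x" "18 \<le> norm x"
  shows "partial_theta (of_real q) x \<noteq> 0"
proof
  assume zero: "partial_theta (of_real q) x = 0"
  define \<tau> where "\<tau> = - ln q"
  define L where "L = ln (norm x)"
  have q_eq: "q = exp (- \<tau>)" using q by (simp add: \<tau>_def)
  have "0 < norm x" using x(2) by linarith
  then have x_eq: "norm x = exp L" by (simp only: L_def exp_ln)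
  have "0 < \<tau>" using q by (simp add: \<tau>_def ln_less_zero)
  have "exp 2 < exp L" using exp_numeral_bounds(5) x(2) x_eq by linarith
  then have "2 \<le> L" by simp
  then have "2\<^sup>2 \<le> L\<^sup>2" by (intro power_mono) auto
  \<comment> \<open>As L^2 \<ge> 4 > \<pi>^2 / 3, the part divided by \<tau> is nonnegative;
    dropping it makes the bound uniform in q.\<close>
  then have "- L \<le> (L\<^sup>2 - pi\<^sup>2 / 3) / \<tau> - L"
    using \<open>0 < \<tau>\<close> pi_squared_less by simp
  then have "exp (- L) \<le> exp ((L\<^sup>2 - pi\<^sup>2 / 3) / \<tau> - L)" by simp
  also have "\<dots> \<le> (norm (full_theta (of_real q) x))\<^sup>2"
    unfolding q_eq using \<open>0 < \<tau>\<close> x_eq x(1) \<open>2 \<le> L\<close> by (intro norm_full_theta_right_halfplane_ge) auto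
  also have "\<dots> \<le> (1 / (norm x - 1))\<^sup>2"
    using norm_partial_theta_ge[of "of_real q" x] q x zero by (intro power_mono) auto
  finally have "1 / norm x \<le> (1 / (norm x - 1))\<^sup>2"
    by (simp add: x_eq exp_minus inverse_eq_divide)
  then have "(norm x - 1)\<^sup>2 \<le> norm x"
    using x(2) \<open>0 < norm x\<close> by (simp add: power_one_over field_simps)
  moreover have "17 * (norm x - 1) \<le> (norm x - 1)\<^sup>2"
    unfolding power2_eq_square using x(2) by (intro mult_right_mono) auto
  ultimately have "17 * (norm x - 1) \<le> norm x" by simp
  with x(2) show False by simp
qed

theorem theorem1:
  shows "(\<forall>q::real. 0 < q \<and> q < 1 \<longrightarrow>
           nonreal_zeros q \<subseteq>
             {x. -5792.7 < Re x \<and> Re x < 0 \<and> \<bar>Im x\<bar> < 132} \<union> {x. norm x < 18}) \<and>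
         (\<forall>q::real. -1 < q \<and> q < 0 \<longrightarrow>
           nonreal_zeros q \<subseteq> {x. \<bar>Re x\<bar> < 364.2 \<and> \<bar>Im x\<bar> < 132})"
proof (intro conjI allI impI subsetI)
  fix q :: real and x
  assume q: "0 < q \<and> q < 1" and x: "x \<in> nonreal_zeros q"
  \<comment> \<open>The disc of radius 132 meets all outer bounds, as 132 is below both 5792.7 and
    364.2; the sign of \<open>Re x\<close> comes from the right half-plane result.\<close>
  then have "norm x < 132"
    by (intro norm_nonreal_zero_less_132[of q]) (auto simp: nonreal_zeros_def)
  then have "\<bar>Re x\<bar> < 132" "\<bar>Im x\<bar> < 132"
    using abs_Re_le_cmod[of x] abs_Im_le_cmod[of x] by linarith+
  moreover have "Re x < 0 \<or> norm x < 18"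
    using no_zeros_right_halfplane[of q x] q x by (force simp: nonreal_zeros_def)
  ultimately show "x \<in> {x. -5792.7 < Re x \<and> Re x < 0 \<and> \<bar>Im x\<bar> < 132} \<union> {x. norm x < 18}"
    by auto
next
  fix q :: real and x
  assume "-1 < q \<and> q < 0" "x \<in> nonreal_zeros q"
  then have "norm x < 132"
    by (intro norm_nonreal_zero_less_132[of q]) (auto simp: nonreal_zeros_def)
  then show "x \<in> {x. \<bar>Re x\<bar> < 364.2 \<and> \<bar>Im x\<bar> < 132}"
    using abs_Re_le_cmod[of x] abs_Im_le_cmod[of x] by auto
qed

end
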